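(* For every integer $k\ge 2$ there exists a constant $C_k$ such that $\mathrm{L}^{(k)}(n)\le t_k(n^{C_k})$ holds for every positive integer $n$.
   Context: For a natural number $N$ let $[N]=\{1,\dots,N\}$, and for a set $X$ let $X^{(k)}$ be the set of all $k$-element subsets of $X$. The tower functions are defined by $t_0(x)=x$ and $t_{i+1}(x)=2^{t_i(x)}$. An ordering means a (strict) linear ordering. For a set $X$ of integers, an ordering $(X^{(k)},\prec)$ is canonical if for any two (finite) sets $A,B\subseteq X$ of the same size the order-preserving map from $A$ to $B$ (with respect to the usual order of the integers) induces an order-preserving map from $(A^{(k)},\prec)$ to $(B^{(k)},\prec)$. For positive integers $k,n$, $\mathrm{L}^{(k)}(n)$ denotes the least integer such that for every $N\ge \mathrm{L}^{(k)}(n)$ and every ordering $([N]^{(k)},\prec)$ there is a set $X\subseteq[N]$ of size $n$ such that $(X^{(k)},\prec)$ is canonical. (Its existence is a theorem of Leeb.) *)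

theory Defs
  imports "HOL-Analysis.Analysis" "HOL-Library.Ramsey"
begin

fun tower :: "nat \<Rightarrow> real \<Rightarrow> real" where
  "tower 0 x = x"
| "tower (Suc i) x = 2 powr tower i x"

text \<open>
  An ordering of the \<open>k\<close>-subsets of \<open>X\<close> is a relation \<open>r\<close> with
  \<open>strict_linear_order_on (nsets X k) r\<close>, read as \<open>P \<prec> Q\<close> iff \<open>(P, Q) \<in> r\<close>.
  For finite sets \<open>A\<close>, \<open>B\<close> of the same size there is exactly one strictly
  monotone bijection \<open>f\<close> from \<open>A\<close> to \<open>B\<close> (up to its values outside \<open>A\<close>), and the map
  it induces on \<open>k\<close>-subsets is the image map.
\<close>

definition canonical :: "nat \<Rightarrow> 'a::linorder set \<Rightarrow> 'a set rel \<Rightarrow> bool" where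
  "canonical k X r \<longleftrightarrow>
     (\<forall>A B f. A \<subseteq> X \<longrightarrow> B \<subseteq> X \<longrightarrow> finite A \<longrightarrow> finite B \<longrightarrow> card A = card B \<longrightarrow>
        bij_betw f A B \<longrightarrow> strict_mono_on A f \<longrightarrow>
        monotone_on (nsets A k) (\<lambda>P Q. (P, Q) \<in> r) (\<lambda>P Q. (P, Q) \<in> r) (\<lambda>P. f ` P))"

text \<open>
  By Leeb's theorem some \<open>M\<close> has the property below for all positive \<open>k\<close> and \<open>n\<close>,
  so \<open>LEAST\<close> selects a genuine minimum.
\<close>

definition leeb_number :: "nat \<Rightarrow> nat \<Rightarrow> nat" where
  "leeb_number k n =
     (LEAST M. \<forall>N\<ge>M. \<forall>r :: nat set rel. strict_linear_order_on (nsets {1..N} k) r \<longrightarrow>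
        (\<exists>X. X \<subseteq> {1..N} \<and> card X = n \<and> canonical k X r))"

end

theory Submission
  imports Defs
begin

text \<open>
  The order is determined by comparing \<open>k\<close>-sets \<open>P\<close>, \<open>Q\<close> that differ in one or two coordinates, so that
  \<open>P \<union> Q\<close> has \<open>k + 1\<close> or \<open>k + 2\<close> elements. The former comparisons form a coloring of \<open>(k + 1)\<close>-sets,
  which the Erdos-Rado argument makes homogeneous at the cost of \<open>k\<close> exponentials. The latter would cost
  one exponential more, but as soon as the former depend only on an initial part of \<open>P \<union> Q\<close>, they become monotone in
  one of their arguments. Monotonicity saves an exponential: when the dependence on the last argument is
  removed, only the dyadic scale of the distance to the place where the predicate flips is recorded, and the new
  points are chosen with strictly decreasing scales, so that the resulting predicate is monotone in its
  new last argument. This goes on until a binary monotone predicate is left, for which a polynomial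
  bound is enough.

  On the homogeneous set every coordinate has a sign, and of any two coordinates one dominates the other.
  Dominance is transitive, and passing from \<open>P\<close> to \<open>Q\<close> one coordinate at a time, while the dominating
  coordinate moves a little in each step, shows that the order is lexicographic along dominance.
\<close>

section \<open>Greedy choice of points with decreasing scales\<close>

text \<open>The price of a round is set by the number of bits in the type of a point over the points
  chosen before it, since choices from an interval of length \<open>2 ^ L\<close> must be paid for
  out of \<open>L\<close> bits. Recording the exact place of a flip would take up to
  \<open>L\<close> bits by itself, which exhausts the budget at once. A dyadic scale takes about the
  logarithm of \<open>L\<close>, so \<open>L\<close> may be a polynomial in the number of points,
  and one round costs one exponential. After \<open>k\<close> rounds the color has arity one and the
  predicates have arity two, where polynomially many points suffice; this gives height exactly
  \<open>k\<close>. All polynomial losses end up in the exponent at the top of the tower.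

  A second obstacle is that homogeneity decides two-coordinate moves only if neither coordinate
  jumps over the other. The canonical set is therefore a sparse part of the homogeneous set: between
  indices that are multiples of \<open>2 * k + 1\<close> there is room for the \<open>2 * k\<close>
  small moves that a path between two tuples requires.\<close>

fun tw :: "nat \<Rightarrow> nat \<Rightarrow> nat" where
  "tw 0 x = x"
| "tw (Suc i) x = 2 ^ tw i x"

lemma tower_tw: "tower i (real x) = real (tw i x)"
  by (induction i) (simp_all add: powr_realpow)

lemma tw_mono: "x \<le> y \<Longrightarrow> tw i x \<le> tw i y"
  by (induction i) simp_all

lemma tw_ge2: "2 \<le> x \<Longrightarrow> 2 \<le> tw i x"
proof (induction i)
  case (Suc i)
  then have "2 ^ 1 \<le> (2::nat) ^ tw i x"
    by (intro power_increasing) auto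
  then show ?case by simp
qed simp

lemma mult_le_power: 
  fixes t c :: nat
  assumes "2 \<le> t" "1 \<le> c"
  shows "t * c \<le> t ^ c"
  using assms(2)
proof (induction c rule: nat_induct_at_least)
  case (Suc c)
  have "t * Suc c = t * c + t" by simp
  also have "\<dots> \<le> t ^ c + t ^ c"
    using Suc self_le_power[of t c] assms(1) by (intro add_mono) auto
  also have "\<dots> \<le> t * t ^ c" using assms(1) by (metis mult_2 mult_le_mono1)
  finally show ?case by simp
qed simp

text \<open>A polynomial loss incurred under \<open>i\<close> exponentials can be moved to the top,
  where it only enlarges the exponent. This keeps the bound in the form of a tower over
  \<open>n ^ C\<close> through all rounds.\<close>

lemma tw_power:
  assumes "2 \<le> x" "1 \<le> c"
  shows "tw i x ^ c \<le> tw i (x ^ c)"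
proof (induction i)
  case (Suc i)
  have "tw i x * c \<le> tw i (x ^ c)"
    using mult_le_power[OF tw_ge2[OF assms(1)] assms(2)] Suc by (rule order_trans)
  then show ?case by (simp flip: power_mult)
qed simp

section \<open>Pigeonhole and density in dyadic windows\<close>

lemma pigeonhole_fibre:
  assumes "finite W" "card (f ` W) \<le> B"
  shows "\<exists>t. card W \<le> card {x \<in> W. f x = t} * B"
proof (rule ccontr)
  assume "\<not> ?thesis"
  then have *: "card {x \<in> W. f x = t} * B < card W" for t by (meson not_le)
  then have ne: "W \<noteq> {}" by fastforce
  define m where "m = Max ((\<lambda>t. card {x \<in> W. f x = t}) ` f ` W)"
  have "card W = (\<Sum>t\<in>f ` W. card {x \<in> W. f x = t})"
    using sum.image_gen[OF assms(1), of "\<lambda>_. 1::nat" f] by simp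
  also have "\<dots> \<le> (\<Sum>t\<in>f ` W. m)"
    unfolding m_def by (intro sum_mono Max_ge) (use assms in auto)
  also have "\<dots> \<le> m * B" using assms by simp
  finally have 1: "card W \<le> m * B" .
  have "m \<in> (\<lambda>t. card {x \<in> W. f x = t}) ` f ` W"
    unfolding m_def by (rule Max_in) (use assms ne in auto)
  then show False using * 1 by (auto simp: not_less[symmetric])
qed

text \<open>The windows with \<open>w - \<kappa> - 1 \<le> u < w\<close> leave out only an initial
  piece of length \<open>2 ^ (w - \<kappa> - 1)\<close>, which holds at most half of the guaranteed
  \<open>2 ^ (w - \<kappa>)\<close> points. If all these windows were too sparse, they would
  together hold less than the other half. So the density drops by a factor of two at most, and the
  scale by \<open>\<kappa> + 1\<close> at most.\<close>

lemma dense_window: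
  fixes R :: "nat set"
  assumes "finite R" "R \<subseteq> {s..<s + 2 ^ w}" "2 ^ w \<le> card R * 2 ^ \<kappa>" "\<kappa> < w"
  shows "\<exists>u. w \<le> u + \<kappa> + 1 \<and> u < w \<and> 2 ^ u \<le> card (R \<inter> {s + 2 ^ u..<s + 2 ^ Suc u}) * 2 ^ Suc \<kappa>"
proof (rule ccontr)
  assume neg: "\<not> ?thesis"
  define a where "a = w - \<kappa> - 1"
  let ?K = "2 ^ Suc \<kappa> :: nat"
  have le: "card (R \<inter> {s + 2 ^ u..<s + 2 ^ Suc u}) * ?K \<le> 2 ^ u" if "a \<le> u" "u < w" for u
  proof -
    have "w \<le> u + \<kappa> + 1" using that unfolding a_def by linarith
    then show ?thesis using neg that by (meson nat_le_linear)
  qed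
  \<comment> \<open>The window bounds telescope, because the lengths of the windows from
    \<open>a\<close> up to \<open>b\<close> add up to \<open>2 ^ b - 2 ^ a\<close>; the summand
    \<open>2 ^ a\<close> is put on the left to avoid subtraction.\<close>
  have "card (R \<inter> {s..<s + 2 ^ b}) * ?K + 2 ^ a \<le> card (R \<inter> {s..<s + 2 ^ a}) * ?K + 2 ^ b"
    if "a \<le> b" "b \<le> w" for b
    using that
  proof (induction b rule: nat_induct_at_least)
    case (Suc b)
    have "R \<inter> {s..<s + 2 ^ Suc b} \<subseteq> (R \<inter> {s..<s + 2 ^ b}) \<union> (R \<inter> {s + 2 ^ b..<s + 2 ^ Suc b})"
      by auto
    then have "card (R \<inter> {s..<s + 2 ^ Suc b}) \<le> card (R \<inter> {s..<s + 2 ^ b}) + card (R \<inter> {s + 2 ^ b..<s + 2 ^ Suc b})"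
      by (meson assms(1) card_Un_le card_mono finite_Int finite_UnI order_trans)
    then have "card (R \<inter> {s..<s + 2 ^ Suc b}) * ?K \<le> card (R \<inter> {s..<s + 2 ^ b}) * ?K + card (R \<inter> {s + 2 ^ b..<s + 2 ^ Suc b}) * ?K"
      by (metis add_mult_distrib mult_le_mono1)
    then show ?case using Suc.IH le[of b] Suc.prems Suc.hyps by simp
  qed simp
  moreover have "R \<inter> {s..<s + 2 ^ w} = R" using assms(2) by auto
  moreover have "a \<le> w" unfolding a_def by simp
  ultimately have "card R * ?K + 2 ^ a \<le> card (R \<inter> {s..<s + 2 ^ a}) * ?K + 2 ^ w"
    using order_refl[of w] by metis
  moreover have "card (R \<inter> {s..<s + 2 ^ a}) \<le> card {s..<s + 2 ^ a}" by (intro card_mono) auto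
  then have "card (R \<inter> {s..<s + 2 ^ a}) * ?K \<le> 2 ^ a * ?K" by simp
  moreover have "2 ^ a * ?K = 2 ^ w"
    using assms(4) unfolding a_def power_add[symmetric] by simp
  moreover have "2 ^ w * 2 \<le> card R * ?K" using assms(3) by simp
  moreover have "(0::nat) < 2 ^ a" by simp
  ultimately show False by linarith
qed

text \<open>Invariant: the candidates \<open>R\<close> lie in a window of length
  \<open>2 ^ w\<close> and fill at least one part in \<open>2 ^ \<kappa>\<close> of it. The least
  candidate is chosen, a dense dyadic window above it replaces the old one, and the candidates in it
  are thinned out to a single type. Each choice lowers \<open>w\<close> by at most
  \<open>\<kappa> + 1\<close> and raises \<open>\<kappa>\<close> by \<open>\<tau> + 1\<close>;
  summed over \<open>n\<close> choices this is the last hypothesis. \<open>Z\<close> holds the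
  points chosen earlier, over which types are taken as well.\<close>

lemma greedy_scales:
  fixes ty :: "nat set \<Rightarrow> nat \<Rightarrow> 't"
  assumes "\<And>S. S \<subseteq> X \<Longrightarrow> card S \<le> M \<Longrightarrow> card (ty S ` X) \<le> 2 ^ \<tau>" and "finite X"
    and "R \<subseteq> X" "R \<subseteq> {v..<v + 2 ^ w}" "2 ^ w \<le> card R * 2 ^ \<kappa>" "Z \<subseteq> X" "card Z + n \<le> M"
    and "n * \<kappa> + n\<^sup>2 * (\<tau> + 1) \<le> w"
  shows "\<exists>s u. (\<forall>a<n. s a \<in> R \<and> u a < w) \<and>
     (\<forall>a b. a < b \<longrightarrow> b < n \<longrightarrow> s a + 2 ^ u a \<le> s b \<and> s b < s a + 2 ^ Suc (u a) \<and> u b < u a) \<and>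
     (\<forall>a b c. a < b \<longrightarrow> a < c \<longrightarrow> b < n \<longrightarrow> c < n \<longrightarrow>
        ty (Z \<union> s ` {..a}) (s b) = ty (Z \<union> s ` {..a}) (s c))"
  using assms(3-)
proof (induction n arbitrary: R v w \<kappa> Z)
  case (Suc n)
  have finR: "finite R" using Suc.prems(1) assms(2) finite_subset by blast
  have neR: "R \<noteq> {}"
  proof
    assume "R = {}"
    then have "(2::nat) ^ w \<le> 0" using Suc.prems(3) by simp
    then show False by simp
  qed
  define s0 where "s0 = Min R"
  have s0: "s0 \<in> R" "\<And>x. x \<in> R \<Longrightarrow> s0 \<le> x" unfolding s0_def using finR neR by auto
  have w: "n * (\<kappa> + \<tau> + 1) + n\<^sup>2 * (\<tau> + 1) + \<kappa> + 1 \<le> w"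
    using Suc.prems(6) by (simp add: power2_eq_square algebra_simps)
  have "R \<subseteq> {s0..<s0 + 2 ^ w}"
  proof
    fix x assume x: "x \<in> R"
    then have "x < v + 2 ^ w" "v \<le> s0" using s0(1) Suc.prems(2) by auto
    then show "x \<in> {s0..<s0 + 2 ^ w}" using s0(2)[OF x] by simp
  qed
  from dense_window[OF finR this Suc.prems(3)] w
  obtain u0 where u0: "w \<le> u0 + \<kappa> + 1" "u0 < w"
    "2 ^ u0 \<le> card (R \<inter> {s0 + 2 ^ u0..<s0 + 2 ^ Suc u0}) * 2 ^ Suc \<kappa>" by auto
  define W1 where "W1 = R \<inter> {s0 + 2 ^ u0..<s0 + 2 ^ Suc u0}"
  define Y where "Y = insert s0 Z"
  have W1X: "W1 \<subseteq> X" and finW1: "finite W1"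
    using Suc.prems(1) finR unfolding W1_def by auto
  have YX: "Y \<subseteq> X" using Suc.prems(1,4) s0(1) unfolding Y_def by auto
  have "finite Z" using Suc.prems(4) assms(2) by (rule finite_subset)
  then have "card Y \<le> Suc (card Z)" unfolding Y_def by (simp add: card_insert_if)
  then have YM: "card Y + n \<le> M" using Suc.prems(5) by simp
  have "card (ty Y ` W1) \<le> card (ty Y ` X)"
    using W1X assms(2) by (intro card_mono) auto
  also have "\<dots> \<le> 2 ^ \<tau>" using assms(1) YX YM by simp
  finally obtain t where t: "card W1 \<le> card {x \<in> W1. ty Y x = t} * 2 ^ \<tau>"
    using pigeonhole_fibre[OF finW1] by blast
  define R' where "R' = {x \<in> W1. ty Y x = t}"
  have "2 ^ u0 \<le> card W1 * 2 ^ Suc \<kappa>" using u0(3) unfolding W1_def .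
  also have "\<dots> \<le> (card R' * 2 ^ \<tau>) * 2 ^ Suc \<kappa>" using t unfolding R'_def by (rule mult_le_mono1)
  also have "\<dots> = card R' * 2 ^ (\<kappa> + \<tau> + 1)" by (simp add: power_add)
  finally have cR': "2 ^ u0 \<le> card R' * 2 ^ (\<kappa> + \<tau> + 1)" .
  have R'X: "R' \<subseteq> X" and R'w: "R' \<subseteq> {s0 + 2 ^ u0..<(s0 + 2 ^ u0) + 2 ^ u0}"
    using W1X unfolding R'_def W1_def by auto
  have wu: "n * (\<kappa> + \<tau> + 1) + n\<^sup>2 * (\<tau> + 1) \<le> u0" using w u0(1) by linarith
  obtain s u where su': "(\<forall>a<n. s a \<in> R' \<and> u a < u0) \<and>
     (\<forall>a b. a < b \<longrightarrow> b < n \<longrightarrow> s a + 2 ^ u a \<le> s b \<and> s b < s a + 2 ^ Suc (u a) \<and> u b < u a) \<and>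
     (\<forall>a b c. a < b \<longrightarrow> a < c \<longrightarrow> b < n \<longrightarrow> c < n \<longrightarrow>
        ty (Y \<union> s ` {..a}) (s b) = ty (Y \<union> s ` {..a}) (s c))"
    using Suc.IH[OF R'X R'w cR' YX YM wu] by (elim exE) (rule that)
  note su = conjunct1[OF su'] conjunct1[OF conjunct2[OF su']] conjunct2[OF conjunct2[OF su']]
  define s' where "s' = case_nat s0 s"
  define u' where "u' = case_nat u0 u"
  have img: "Z \<union> s' ` {..Suc a} = Y \<union> s ` {..a}" for a
    unfolding Y_def s'_def by (auto simp: atMost_Suc_eq_insert_0 image_image)
  have img0: "Z \<union> s' ` {..0} = Y" unfolding Y_def s'_def by auto
  have tyY: "ty Y (s a) = t" "s a \<in> R" "s0 + 2 ^ u0 \<le> s a" "s a < s0 + 2 ^ Suc u0" if "a < n" for a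
    using su(1)[rule_format, OF that] unfolding R'_def W1_def by auto
  show ?case
  proof (rule exI[of _ s'], rule exI[of _ u'], intro conjI allI impI)
    fix a assume "a < Suc n"
    then show "s' a \<in> R" "u' a < w"
      using s0(1) u0(2) su(1) tyY(2) by (cases a; fastforce simp: s'_def u'_def)+
  next
    fix a b assume ab: "a < b" "b < Suc n"
    then obtain b' where b': "b = Suc b'" "b' < n" by (cases b) auto
    show "s' a + 2 ^ u' a \<le> s' b" "s' b < s' a + 2 ^ Suc (u' a)" "u' b < u' a"
    proof (atomize (full), cases a)
      case 0
      then show "s' a + 2 ^ u' a \<le> s' b \<and> s' b < s' a + 2 ^ Suc (u' a) \<and> u' b < u' a"
        using tyY(3,4)[OF b'(2)] su(1) b' by (simp add: s'_def u'_def)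
    next
      case (Suc a')
      then show "s' a + 2 ^ u' a \<le> s' b \<and> s' b < s' a + 2 ^ Suc (u' a) \<and> u' b < u' a"
        using su(2)[rule_format, of a' b'] ab b' by (simp add: s'_def u'_def)
    qed
  next
    fix a b c assume abc: "a < b" "a < c" "b < Suc n" "c < Suc n"
    then obtain b' c' where b': "b = Suc b'" "b' < n" "c = Suc c'" "c' < n" by (cases b; cases c) auto
    show "ty (Z \<union> s' ` {..a}) (s' b) = ty (Z \<union> s' ` {..a}) (s' c)"
    proof (cases a)
      case 0
      then show ?thesis using img0 b' tyY(1) by (simp add: s'_def)
    next
      case (Suc a')
      then show ?thesis using su(3)[rule_format, of a' b' c'] img[of a'] abc b' by (simp add: s'_def)
    qed
  qed
qed simp

lemma card_nsets_le: "card (nsets S h) \<le> card S ^ h"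
  by (cases "h \<le> card S") (simp_all add: binomial_le_pow binomial_eq_0 not_le)

text \<open>A count in bits: \<open>p\<close> for each color, and for each predicate
  \<open>lg\<close> for the scale, one for the persisting value and one for a truth value of
  \<open>W\<close>. The scale has \<open>L + 1\<close> possible values, so \<open>L\<close> enters
  only through \<open>lg\<close>.\<close>

lemma card_types_le:
  fixes col :: "nat \<Rightarrow> nat set \<Rightarrow> 'c" and vl :: "nat \<Rightarrow> nat set \<times> 'a \<Rightarrow> bool \<times> nat"
    and W :: "nat \<Rightarrow> nat set \<times> 'a \<Rightarrow> bool"
  assumes "finite Col" "card Col \<le> 2 ^ p" "finite A" "card A \<le> q" "finite S" "card S \<le> M" "1 \<le> M"
    and "Suc L \<le> 2 ^ lg"
    and "\<And>x D. x \<in> X \<Longrightarrow> D \<in> nsets S h \<Longrightarrow> col x D \<in> Col"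
    and "\<And>x P. snd (vl x P) \<le> L"
  shows "card ((\<lambda>x. (restrict (col x) (nsets S h), restrict (vl x) (nsets S h \<times> A),
      restrict (W x) (nsets S (Suc h) \<times> A))) ` X) \<le> 2 ^ (M ^ Suc h * (p + q * (lg + 2)))"
proof -
  let ?B = "UNIV \<times> {..L} :: (bool \<times> nat) set"
  let ?P = "PiE (nsets S h) (\<lambda>_. Col)" and ?Q = "PiE (nsets S h \<times> A) (\<lambda>_. ?B)"
    and ?R = "PiE (nsets S (Suc h) \<times> A) (\<lambda>_. UNIV :: bool set)"
  define m where "m = M ^ Suc h"
  have fin: "finite (nsets S h)" "finite (nsets S (Suc h))" using assms(5) finite_imp_finite_nsets by blast+
  have le1: "card (nsets S h) \<le> m"
  proof -
    have "card (nsets S h) \<le> card S ^ h" by (rule card_nsets_le)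
    also have "\<dots> \<le> M ^ h" using assms(6) by (rule power_mono) simp
    also have "\<dots> \<le> m" using assms(7) unfolding m_def by simp
    finally show ?thesis .
  qed
  have le2: "card (nsets S (Suc h)) \<le> m"
    using card_nsets_le[of S "Suc h"] power_mono[OF assms(6), of "Suc h"] unfolding m_def by simp
  have "card (?P \<times> ?Q \<times> ?R) = card Col ^ card (nsets S h) * ((2 * Suc L) ^ (card (nsets S h) * card A) *
      2 ^ (card (nsets S (Suc h)) * card A))"
    using fin assms(3) by (simp add: card_cartesian_product card_PiE)
  also have "\<dots> \<le> (2 ^ p) ^ m * ((2 ^ (lg + 1)) ^ (m * q) * 2 ^ (m * q))"
  proof (intro mult_le_mono)
    have "card Col ^ card (nsets S h) \<le> (2 ^ p) ^ card (nsets S h)"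
      using assms(2) by (rule power_mono) simp
    also have "\<dots> \<le> (2 ^ p) ^ m" using le1 by (intro power_increasing) auto
    finally show "card Col ^ card (nsets S h) \<le> (2 ^ p) ^ m" .
    have "(2 * Suc L) ^ (card (nsets S h) * card A) \<le> (2 ^ (lg + 1)) ^ (card (nsets S h) * card A)"
      using assms(8) by (intro power_mono) auto
    also have "\<dots> \<le> (2 ^ (lg + 1)) ^ (m * q)" using le1 assms(4) by (intro power_increasing mult_le_mono) auto
    finally show "(2 * Suc L) ^ (card (nsets S h) * card A) \<le> (2 ^ (lg + 1)) ^ (m * q)" .
    show "(2::nat) ^ (card (nsets S (Suc h)) * card A) \<le> 2 ^ (m * q)"
      using le2 assms(4) by (intro power_increasing mult_le_mono) auto
  qed
  also have "\<dots> = 2 ^ (m * (p + q * (lg + 2)))"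
    unfolding power_mult[symmetric] power_add[symmetric] by (simp add: algebra_simps)
  finally have "card (?P \<times> ?Q \<times> ?R) \<le> 2 ^ (M ^ Suc h * (p + q * (lg + 2)))" unfolding m_def .
  moreover have "(\<lambda>x. (restrict (col x) (nsets S h), restrict (vl x) (nsets S h \<times> A),
      restrict (W x) (nsets S (Suc h) \<times> A))) ` X \<subseteq> ?P \<times> ?Q \<times> ?R"
    using assms(9,10) by (auto simp: PiE_def extensional_def mem_Times_iff)
  moreover have "finite (?P \<times> ?Q \<times> ?R)"
    using fin assms(1,3) by (intro finite_cartesian_product finite_PiE) auto
  ultimately show ?thesis by (meson card_mono order_trans)
qed

section \<open>Removing the last argument\<close>

text \<open>
  The value \<open>v\<close> is the one that persists once it is attained: \<open>v = True\<close> means that \<open>W\<close> increases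
  with its last argument, \<open>v = False\<close> that it decreases.
\<close>

definition class_monotone :: "nat \<Rightarrow> nat \<Rightarrow> (nat set \<Rightarrow> 'c) \<Rightarrow> (nat set \<Rightarrow> bool) \<Rightarrow> bool" where
  "class_monotone N r col W \<longleftrightarrow>
     (\<forall>D x \<gamma>. D \<subseteq> {..<x} \<longrightarrow> x < N \<longrightarrow> Suc (card D) = r \<longrightarrow>
        (\<exists>v. \<forall>y y'. x < y \<longrightarrow> y < y' \<longrightarrow> y' < N \<longrightarrow> col (insert y D) = \<gamma> \<longrightarrow> col (insert y' D) = \<gamma> \<longrightarrow>
           W (insert y (insert x D)) = v \<longrightarrow> W (insert y' (insert x D)) = v))"

text \<open>One Erdos-Rado round on \<open>2 ^ L\<close> points. The type of \<open>x\<close> also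
  records, for each \<open>D\<close> of size \<open>h\<close>, the persisting value of
  \<open>W a\<close> as the point after \<open>x\<close> varies and the scale at which this value
  first occurs. The last conclusion is the gain from the scales: once \<open>d\<close> has been
  fixed, the predicate is again monotone in its new last argument, with \<open>v\<close> passing
  from larger to smaller points.\<close>

lemma end_homogeneous:
  fixes col :: "nat set \<Rightarrow> 'c" and W :: "'a \<Rightarrow> nat set \<Rightarrow> bool"
  assumes h: "1 \<le> h" and Col: "finite Col" "card Col \<le> 2 ^ p" "Col \<noteq> {}"
    and A: "finite A" "card A \<le> q"
    and col: "\<And>V. V \<in> nsets {..<N} (Suc h) \<Longrightarrow> col V \<in> Col"
    and \<tau>: "\<tau> = M ^ Suc h * (p + q * (lg + 2))" and lg: "Suc L \<le> 2 ^ lg"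
    and L: "M\<^sup>2 * (\<tau> + 1) \<le> L" and N: "2 ^ L \<le> N" and M: "1 \<le> M"
  shows "\<exists>s. strict_mono_on {..<M} s \<and> s ` {..<M} \<subseteq> {..<N} \<and>
     (\<forall>V z z'. V \<subseteq> {..<z} \<longrightarrow> V \<subseteq> {..<z'} \<longrightarrow> z < M \<longrightarrow> z' < M \<longrightarrow> card V = h \<longrightarrow>
        col (insert (s z) (s ` V)) = col (insert (s z') (s ` V))) \<and>
     (\<forall>a\<in>A. \<forall>V z z'. V \<subseteq> {..<z} \<longrightarrow> V \<subseteq> {..<z'} \<longrightarrow> z < M \<longrightarrow> z' < M \<longrightarrow> card V = Suc h \<longrightarrow>
        W a (insert (s z) (s ` V)) = W a (insert (s z') (s ` V))) \<and>
     (\<forall>a\<in>A. class_monotone N (Suc h) col (W a) \<longrightarrow>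
        (\<forall>D. card D = h \<longrightarrow> (\<exists>v. \<forall>b c d. D \<subseteq> {..<b} \<longrightarrow> b < c \<longrightarrow> c < d \<longrightarrow> d < M \<longrightarrow>
           W a (insert (s d) (insert (s c) (s ` D))) = v \<longrightarrow>
           W a (insert (s d) (insert (s b) (s ` D))) = v)))"
proof -
  obtain c0 where c0: "c0 \<in> Col" using Col(3) by blast
  define X where "X = {..<(2::nat) ^ L}"
  \<comment> \<open>The relevant color class is read off from \<open>x\<close> itself: along the
    chosen sequence, points later than \<open>x\<close> have the same type as \<open>x\<close> over
    the points of \<open>D\<close>, hence the same color with \<open>D\<close>.\<close>
  define vv where "vv = (\<lambda>x (D, a). SOME v. \<forall>y y'. x < y \<longrightarrow> y < y' \<longrightarrow> y' < N \<longrightarrow>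
     col (insert y D) = col (insert x D) \<longrightarrow> col (insert y' D) = col (insert x D) \<longrightarrow>
     W a (insert y (insert x D)) = v \<longrightarrow> W a (insert y' (insert x D)) = v)"
  define P where "P = (\<lambda>x (D, a) u. \<exists>y\<in>X. x < y \<and> y < x + 2 ^ Suc u \<and> col (insert y D) = col (insert x D) \<and>
     W a (insert y (insert x D)) = vv x (D, a))"
  \<comment> \<open>The alternative \<open>L \<le> u\<close> caps the scale if the value never
    occurs; it makes the minimum exist and leaves only \<open>L + 1\<close> values to count.\<close>
  define ll where "ll = (\<lambda>x Da. LEAST u. L \<le> u \<or> P x Da u)"
  \<comment> \<open>For \<open>x \<in> D\<close> the set \<open>insert x D\<close> is too small, and
    its color might lie outside \<open>Col\<close>; the default \<open>c0\<close> keeps the count of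
    types valid.\<close>
  define ch where "ch = (\<lambda>x D. if x \<in> D then c0 else col (insert x D))"
  define ty where "ty = (\<lambda>S x. (restrict (ch x) (nsets S h), restrict (\<lambda>Da. (vv x Da, ll x Da)) (nsets S h \<times> A),
      restrict (\<lambda>(V, a). W a (insert x V)) (nsets S (Suc h) \<times> A)))"
  have XN: "X \<subseteq> {..<N}" using N unfolding X_def by auto
  have bound: "card (ty S ` X) \<le> 2 ^ \<tau>" if S: "S \<subseteq> X" "card S \<le> M" for S
    unfolding ty_def \<tau>
  proof (rule card_types_le[OF Col(1,2) A _ S(2) M lg])
    show "finite S" using S(1) unfolding X_def by (rule finite_subset) simp
    show "ch x D \<in> Col" if "x \<in> X" "D \<in> nsets S h" for x D
    proof (cases "x \<in> D")
      case False
      then have "insert x D \<in> nsets {..<N} (Suc h)"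
        using that S(1) XN by (auto simp: nsets_def)
      then show ?thesis using col False unfolding ch_def by simp
    qed (simp add: ch_def c0)
    show "snd (vv x Da, ll x Da) \<le> L" for x Da
      unfolding ll_def by (auto intro: Least_le)
  qed
  have "finite X" "X \<subseteq> {0..<0 + 2 ^ L}" "2 ^ L \<le> card X * 2 ^ 0" "M * 0 + M\<^sup>2 * (\<tau> + 1) \<le> L"
    unfolding X_def using L by auto
  have "\<exists>s u. (\<forall>a<M. s a \<in> X \<and> u a < L) \<and>
     (\<forall>a b. a < b \<longrightarrow> b < M \<longrightarrow> s a + 2 ^ u a \<le> s b \<and> s b < s a + 2 ^ Suc (u a) \<and> u b < u a) \<and>
     (\<forall>a b c. a < b \<longrightarrow> a < c \<longrightarrow> b < M \<longrightarrow> c < M \<longrightarrow>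
        ty ({} \<union> s ` {..a}) (s b) = ty ({} \<union> s ` {..a}) (s c))"
    by (rule greedy_scales[where M = M, OF bound \<open>finite X\<close> subset_refl \<open>X \<subseteq> {0..<0 + 2 ^ L}\<close>
          \<open>2 ^ L \<le> card X * 2 ^ 0\<close> empty_subsetI _ \<open>M * 0 + M\<^sup>2 * (\<tau> + 1) \<le> L\<close>]) auto
  then obtain s u where su': "(\<forall>a<M. s a \<in> X \<and> u a < L) \<and>
     (\<forall>a b. a < b \<longrightarrow> b < M \<longrightarrow> s a + 2 ^ u a \<le> s b \<and> s b < s a + 2 ^ Suc (u a) \<and> u b < u a) \<and>
     (\<forall>a b c. a < b \<longrightarrow> a < c \<longrightarrow> b < M \<longrightarrow> c < M \<longrightarrow>
        ty ({} \<union> s ` {..a}) (s b) = ty ({} \<union> s ` {..a}) (s c))"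
    by (elim exE) (rule that)
  have sX: "s a \<in> X" "u a < L" if "a < M" for a using su' that by auto
  have win: "s a + 2 ^ u a \<le> s b" "s b < s a + 2 ^ Suc (u a)" "u b < u a" if "a < b" "b < M" for a b
    using su' that by auto
  have mono: "strict_mono_on {..<M} s"
  proof (rule strict_mono_onI)
    fix a b assume ab: "a \<in> {..<M}" "b \<in> {..<M}" "a < b"
    have "s a + 1 \<le> s a + 2 ^ u a" by simp
    also have "\<dots> \<le> s b" using win(1) ab by simp
    finally show "s a < s b" by simp
  qed
  have inj: "inj_on s {..<M}" using mono by (rule strict_mono_on_imp_inj_on)
  have tyeq: "ty (s ` {..a}) (s b) = ty (s ` {..a}) (s c)" if "a < b" "a < c" "b < M" "c < M" for a b c
    using conjunct2[OF conjunct2[OF su'], rule_format, OF that] by simp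
  have fact: "ch (s z) (s ` V) = ch (s z') (s ` V) \<and> 
       (a \<in> A \<longrightarrow> vv (s z) (s ` V, a) = vv (s z') (s ` V, a) \<and> ll (s z) (s ` V, a) = ll (s z') (s ` V, a))"
    if V: "V \<subseteq> {..<z}" "V \<subseteq> {..<z'}" "z < M" "z' < M" "card V = h" for V z z' a
  proof -
    \<comment> \<open>Since \<open>1 \<le> h\<close>, the set \<open>V\<close> has a largest index,
      and all points chosen after that index have the same type over the points chosen so
      far.\<close>
    have "finite V" "V \<noteq> {}" using V h finite_subset by fastforce+
    then have m: "Max V < z" "Max V < z'" "V \<subseteq> {..Max V}" using V by auto
    have "inj_on s V" using inj by (rule inj_on_subset) (use V in auto)
    then have mem: "s ` V \<in> nsets (s ` {..Max V}) h"
      using m V \<open>finite V\<close> by (auto simp: nsets_def card_image)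
    note eq = tyeq[OF m(1,2) V(3,4), unfolded ty_def prod.inject]
    show ?thesis
      using fun_cong[OF conjunct1[OF eq], of "s ` V"]
        fun_cong[OF conjunct1[OF conjunct2[OF eq]], of "(s ` V, a)"] mem by (cases "a \<in> A") simp_all
  qed
  have notin: "s z \<notin> s ` V" if "V \<subseteq> {..<z}" "z < M" for V z
  proof
    assume "s z \<in> s ` V"
    then obtain y where "y \<in> V" "s z = s y" by auto
    then show False using inj_onD[OF inj, of z y] that by auto
  qed
  have chi: "col (insert (s z) (s ` V)) = col (insert (s z') (s ` V))"
    if "V \<subseteq> {..<z}" "V \<subseteq> {..<z'}" "z < M" "z' < M" "card V = h" for V z z'
    using fact[OF that] notin that unfolding ch_def by simp
  have Weq: "W a (insert (s z) (s ` V)) = W a (insert (s z') (s ` V))"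
    if V: "V \<subseteq> {..<z}" "V \<subseteq> {..<z'}" "z < M" "z' < M" "card V = Suc h" "a \<in> A" for V z z' a
  proof -
    have "finite V" "V \<noteq> {}" using V h finite_subset by fastforce+
    then have m: "Max V < z" "Max V < z'" "V \<subseteq> {..Max V}" using V by auto
    have "inj_on s V" using inj by (rule inj_on_subset) (use V in auto)
    then have mem: "s ` V \<in> nsets (s ` {..Max V}) (Suc h)"
      using m V \<open>finite V\<close> by (auto simp: nsets_def card_image)
    note eq = tyeq[OF m(1,2) V(3,4), unfolded ty_def prod.inject]
    show ?thesis
      using fun_cong[OF conjunct2[OF conjunct2[OF eq]], of "(s ` V, a)"] mem V(6) by simp
  qed
  \<comment> \<open>A flip for \<open>s c\<close> within its scale bounds the common value of \<open>ll\<close> below the larger scale of \<open>s b\<close>.\<close>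
  have scale: "\<exists>v. \<forall>b c d. D \<subseteq> {..<b} \<longrightarrow> b < c \<longrightarrow> c < d \<longrightarrow> d < M \<longrightarrow>
           W a (insert (s d) (insert (s c) (s ` D))) = v \<longrightarrow>
           W a (insert (s d) (insert (s b) (s ` D))) = v"
    if a: "a \<in> A" "class_monotone N (Suc h) col (W a)" and D: "card D = h" for a D
  proof (intro exI[of _ "vv (s (Suc (Max D))) (s ` D, a)"] allI impI)
    fix b c d
    assume bcd: "D \<subseteq> {..<b}" "b < c" "c < d" "d < M"
      and W: "W a (insert (s d) (insert (s c) (s ` D))) = vv (s (Suc (Max D))) (s ` D, a)"
    let ?D = "s ` D"
    have Dc: "D \<subseteq> {..<c}" "D \<subseteq> {..<d}" "b < M" "c < M" using bcd by force+
    have "finite D" "D \<noteq> {}" using bcd(1) D h finite_subset by fastforce+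
    then have "Max D < b" and m: "D \<subseteq> {..<Suc (Max D)}" using bcd by (auto simp: less_Suc_eq_le)
    then have m2: "Suc (Max D) < M" using bcd by simp
    have v: "vv (s (Suc (Max D))) (?D, a) = vv (s c) (?D, a)" "vv (s b) (?D, a) = vv (s c) (?D, a)"
      and l: "ll (s b) (?D, a) = ll (s c) (?D, a)"
      using fact[OF m Dc(1) m2 Dc(4) D, of a] fact[OF bcd(1) Dc(1) Dc(3,4) D, of a] a(1) by auto
    have "P (s c) (?D, a) (u c)"
      unfolding P_def case_prod_conv
      using win(1,2)[OF bcd(3,4)] sX[OF bcd(4)] chi[OF Dc(1,2,4) bcd(4) D] W v strict_mono_onD[OF mono, of c d] bcd Dc
      by (intro bexI[of _ "s d"]) auto
    then have "ll (s c) (?D, a) \<le> u c" unfolding ll_def by (intro Least_le) simp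
    then have lb: "ll (s b) (?D, a) < u b" using win(3)[OF bcd(2)] Dc l by simp
    have "L \<le> ll (s b) (?D, a) \<or> P (s b) (?D, a) (ll (s b) (?D, a))"
      unfolding ll_def by (rule LeastI[of _ L]) simp
    then have "P (s b) (?D, a) (ll (s b) (?D, a))" using lb sX(2)[OF Dc(3)] by auto
    then obtain y where y: "y \<in> X" "s b < y" "y < s b + 2 ^ Suc (ll (s b) (?D, a))"
       "col (insert y ?D) = col (insert (s b) ?D)" "W a (insert y (insert (s b) ?D)) = vv (s b) (?D, a)"
      unfolding P_def by auto
    have "2 ^ Suc (ll (s b) (?D, a)) \<le> (2::nat) ^ u b" using lb by (intro power_increasing) auto
    then have "y < s d" using y(3) win(1)[of b d] bcd by simp
    have "?D \<subseteq> {..<s b}"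
      using strict_mono_onD[OF mono, of _ b] bcd(1) Dc by fastforce
    moreover have "D \<subseteq> {..<M}" using bcd by force
    then have "card ?D = h"
      using D card_image[OF inj_on_subset[OF inj]] by simp
    moreover have "s b < N" "s d < N" using sX XN Dc bcd by blast+
    ultimately have "\<exists>v. \<forall>y y'. s b < y \<longrightarrow> y < y' \<longrightarrow> y' < N \<longrightarrow>
     col (insert y ?D) = col (insert (s b) ?D) \<longrightarrow> col (insert y' ?D) = col (insert (s b) ?D) \<longrightarrow>
     W a (insert y (insert (s b) ?D)) = v \<longrightarrow> W a (insert y' (insert (s b) ?D)) = v"
      by (intro a(2)[unfolded class_monotone_def, THEN spec, THEN spec, THEN spec, THEN mp, THEN mp, THEN mp]) simp_all
    from someI_ex[OF this] have vmono: "\<forall>y y'. s b < y \<longrightarrow> y < y' \<longrightarrow> y' < N \<longrightarrow>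
     col (insert y ?D) = col (insert (s b) ?D) \<longrightarrow> col (insert y' ?D) = col (insert (s b) ?D) \<longrightarrow>
     W a (insert y (insert (s b) ?D)) = vv (s b) (?D, a) \<longrightarrow> W a (insert y' (insert (s b) ?D)) = vv (s b) (?D, a)"
      unfolding vv_def case_prod_conv .
    have "col (insert (s d) ?D) = col (insert (s b) ?D)"
      using chi[OF bcd(1) Dc(2,3) bcd(4) D] by (rule sym)
    from vmono[rule_format, OF y(2) \<open>y < s d\<close> \<open>s d < N\<close> y(4) this y(5)]
    have "W a (insert (s d) (insert (s b) ?D)) = vv (s b) (?D, a)" .
    then show "W a (insert (s d) (insert (s b) ?D)) = vv (s (Suc (Max D))) (?D, a)" using v by simp
  qed
  show ?thesis
    using mono sX XN chi Weq scale by (intro exI[of _ s]) blast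
qed

text \<open>
  Here \<open>W\<close> is monotone in an argument that is followed by \<open>d\<close> further ones. When \<open>W\<close> comes from an order,
  the direction is the sign of moving \<open>y\<close> to \<open>y'\<close>, which involves one of these further arguments less.
  Hence the direction becomes known one step before \<open>y\<close> is the last argument of \<open>W\<close>.
\<close>

definition deferred_monotone :: "nat \<Rightarrow> nat \<Rightarrow> nat \<Rightarrow> (nat set \<Rightarrow> 'c) \<Rightarrow> (nat set \<Rightarrow> bool) \<Rightarrow> bool" where
  "deferred_monotone d N r col W \<longleftrightarrow> (if d = 0 then class_monotone N r col W else
     (\<exists>dir. \<forall>D x y y' E. D \<subseteq> {..<x} \<longrightarrow> x < y \<longrightarrow> y < y' \<longrightarrow> E \<subseteq> {y'<..<N} \<longrightarrow>
        card E = d \<longrightarrow> Suc (card D + card E) = r \<longrightarrow>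
        (\<exists>e\<in>E. W (insert x (insert y (D \<union> E))) = dir (col (insert y (insert y' (D \<union> (E - {e}))))) \<longrightarrow>
               W (insert x (insert y' (D \<union> E))) = dir (col (insert y (insert y' (D \<union> (E - {e}))))))))"

text \<open>Fixing the last argument at \<open>s m\<close> shortens the tail behind the monotone
  argument by one. If there is no tail, monotonicity in the lost argument is replaced by the
  monotonicity that the scales provide, which is why truncated subtraction is right in
  \<open>d - 1\<close>. If there is one, the color that determines the direction has to be rewritten
  as a color with last point \<open>s m\<close>, and end-homogeneity of \<open>col\<close> permits
  this.\<close>

lemma deferred_monotone_step:
  fixes col :: "nat set \<Rightarrow> 'c"
  assumes mono: "strict_mono_on {..<Suc m} s" and range: "s ` {..<Suc m} \<subseteq> {..<N}"
    and hom: "\<And>V z z'. V \<subseteq> {..<z} \<Longrightarrow> V \<subseteq> {..<z'} \<Longrightarrow> z < Suc m \<Longrightarrow> z' < Suc m \<Longrightarrow> card V = Suc g \<Longrightarrow>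
        col (insert (s z) (s ` V)) = col (insert (s z') (s ` V))"
    and scale: "class_monotone N (Suc (Suc g)) col W \<Longrightarrow>
        (\<forall>D. card D = Suc g \<longrightarrow> (\<exists>v. \<forall>b c d. D \<subseteq> {..<b} \<longrightarrow> b < c \<longrightarrow> c < d \<longrightarrow> d < Suc m \<longrightarrow>
           W (insert (s d) (insert (s c) (s ` D))) = v \<longrightarrow>
           W (insert (s d) (insert (s b) (s ` D))) = v))"
    and deferred_monotone: "deferred_monotone d N (Suc (Suc g)) col W"
  shows "deferred_monotone (d - 1) m (Suc g) (\<lambda>V. col (insert (s m) (s ` V))) (\<lambda>V. W (insert (s m) (s ` V)))"
proof (cases d)
  case 0
  then have sc: "\<forall>D. card D = Suc g \<longrightarrow> (\<exists>v. \<forall>b c d. D \<subseteq> {..<b} \<longrightarrow> b < c \<longrightarrow> c < d \<longrightarrow> d < Suc m \<longrightarrow>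
           W (insert (s d) (insert (s c) (s ` D))) = v \<longrightarrow>
           W (insert (s d) (insert (s b) (s ` D))) = v)"
    using scale deferred_monotone unfolding deferred_monotone_def by simp
  have "class_monotone m (Suc g) (\<lambda>V. col (insert (s m) (s ` V))) (\<lambda>V. W (insert (s m) (s ` V)))"
    unfolding class_monotone_def
  proof (intro allI impI)
    fix D x \<gamma> assume D: "D \<subseteq> {..<x}" "x < m" "Suc (card D) = Suc g"
    have fin: "finite D" using D(1) by (rule finite_subset) simp
    have "card (insert x D) = Suc g" using D fin by (subst card_insert_disjoint) auto
    from sc[THEN spec, THEN mp, OF this] obtain v where v: "\<forall>b c d. insert x D \<subseteq> {..<b} \<longrightarrow> b < c \<longrightarrow> c < d \<longrightarrow> d < Suc m \<longrightarrow>
           W (insert (s d) (insert (s c) (s ` insert x D))) = v \<longrightarrow>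
           W (insert (s d) (insert (s b) (s ` insert x D))) = v"
      by (elim exE) (rule that)
    show "\<exists>v. \<forall>y y'. x < y \<longrightarrow> y < y' \<longrightarrow> y' < m \<longrightarrow>
           col (insert (s m) (s ` insert y D)) = \<gamma> \<longrightarrow> col (insert (s m) (s ` insert y' D)) = \<gamma> \<longrightarrow>
           W (insert (s m) (s ` insert y (insert x D))) = v \<longrightarrow>
           W (insert (s m) (s ` insert y' (insert x D))) = v"
    \<comment> \<open>Since \<open>v\<close> passes from larger to smaller points, it is the
      opposite value that persists upwards.\<close>
    proof (intro exI[of _ "\<not> v"] allI impI)
      fix y y' assume y: "x < y" "y < y'" "y' < m"
        "W (insert (s m) (s ` insert y (insert x D))) = (\<not> v)"
      have "insert x D \<subseteq> {..<y}" using D y by auto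
      from v[THEN spec, THEN spec, THEN spec, THEN mp, OF this, THEN mp, OF y(2), THEN mp, OF y(3), THEN mp, OF lessI] y(4)
      show "W (insert (s m) (s ` insert y' (insert x D))) = (\<not> v)"
        unfolding image_insert by (cases v) simp_all
    qed
  qed
  then show ?thesis using 0 unfolding deferred_monotone_def by simp
next
  case (Suc e)
  have inj: "inj_on s {..<Suc m}" using mono by (rule strict_mono_on_imp_inj_on)
  have less: "s a < s b" if "a < b" "b \<le> m" for a b
    using strict_mono_onD[OF mono, of a b] that by auto
  have sN: "s z < N" if "z \<le> m" for z using range that by (auto simp: image_subset_iff less_Suc_eq_le)
  obtain dir where dir: "\<forall>D x y y' E. D \<subseteq> {..<x} \<longrightarrow> x < y \<longrightarrow> y < y' \<longrightarrow> E \<subseteq> {y'<..<N} \<longrightarrow>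
        card E = Suc e \<longrightarrow> Suc (card D + card E) = Suc (Suc g) \<longrightarrow>
        (\<exists>e\<in>E. W (insert x (insert y (D \<union> E))) = dir (col (insert y (insert y' (D \<union> (E - {e}))))) \<longrightarrow>
               W (insert x (insert y' (D \<union> E))) = dir (col (insert y (insert y' (D \<union> (E - {e}))))))"
    using deferred_monotone Suc unfolding deferred_monotone_def by (auto split: if_splits)
  have step: "\<exists>e'. (e' = s m \<or> e' \<in> s ` E) \<and>
      (W (insert (s m) (s ` insert x (insert y (D \<union> E)))) =
         dir (col (insert (s y) (insert (s y') (s ` D \<union> (insert (s m) (s ` E) - {e'}))))) \<longrightarrow>
       W (insert (s m) (s ` insert x (insert y' (D \<union> E)))) =
         dir (col (insert (s y) (insert (s y') (s ` D \<union> (insert (s m) (s ` E) - {e'}))))))"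
    if D: "D \<subseteq> {..<x}" "x < y" "y < y'" "E \<subseteq> {y'<..<m}" "y' < m" "card E = e" "Suc (card D + card E) = Suc g" for D x y y' E
  proof -
    have fin: "finite D" "finite E" using D(1,4) by (auto intro: finite_subset)
    have sub: "D \<subseteq> {..<Suc m}" "E \<subseteq> {..<Suc m}" using D by auto
    then have cards: "card (s ` D) = card D" "card (s ` E) = card E"
      using inj by (meson card_image inj_on_subset)+
    have "s m \<notin> s ` E"
    proof
      assume "s m \<in> s ` E"
      then obtain z where "z \<in> E" "s z = s m" by auto
      then show False using less[of z m] D(4) by auto
    qed
    then have "card (insert (s m) (s ` E)) = Suc e" using fin cards D(6) by simp
    moreover have "s ` D \<subseteq> {..<s x}"
    proof
      fix w assume "w \<in> s ` D"
      then obtain z where "z \<in> D" "w = s z" by blast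
      then show "w \<in> {..<s x}" using less[of z x] D(1,2,3,5) by auto
    qed
    moreover have "s x < s y" "s y < s y'" using less D by auto
    moreover have "insert (s m) (s ` E) \<subseteq> {s y'<..<N}"
    proof
      fix w assume "w \<in> insert (s m) (s ` E)"
      then obtain z where z: "z \<in> insert m E" "w = s z" by blast
      then have "y' < z" "z \<le> m" using D(4,5) by auto
      then show "w \<in> {s y'<..<N}" using less[of y' z] sN[of z] z(2) by simp
    qed
    moreover have "Suc (card (s ` D) + Suc e) = Suc (Suc g)" using cards D(6,7) by simp
    ultimately have "\<exists>e'\<in>insert (s m) (s ` E). 
        W (insert (s x) (insert (s y) (s ` D \<union> insert (s m) (s ` E)))) = dir (col (insert (s y) (insert (s y') (s ` D \<union> (insert (s m) (s ` E) - {e'}))))) \<longrightarrow>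
         W (insert (s x) (insert (s y') (s ` D \<union> insert (s m) (s ` E)))) = dir (col (insert (s y) (insert (s y') (s ` D \<union> (insert (s m) (s ` E) - {e'})))))"
      by (intro dir[rule_format]) simp_all
    then obtain e' where e1: "e' \<in> insert (s m) (s ` E)" and e2:
        "W (insert (s x) (insert (s y) (s ` D \<union> insert (s m) (s ` E)))) = dir (col (insert (s y) (insert (s y') (s ` D \<union> (insert (s m) (s ` E) - {e'}))))) \<longrightarrow>
         W (insert (s x) (insert (s y') (s ` D \<union> insert (s m) (s ` E)))) = dir (col (insert (s y) (insert (s y') (s ` D \<union> (insert (s m) (s ` E) - {e'})))))"
      by (elim bexE) (rule that)
    have eq: "insert (s m) (s ` insert x (insert z (D \<union> E))) = insert (s x) (insert (s z) (s ` D \<union> insert (s m) (s ` E)))" for z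
      by (simp add: insert_commute image_Un)
    have "e' = s m \<or> e' \<in> s ` E" using e1 by simp
    then show ?thesis unfolding eq using e2 by (intro exI[of _ e'] conjI)
  qed
  show ?thesis
  proof (cases e)
    case 0
    have "class_monotone m (Suc g) (\<lambda>V. col (insert (s m) (s ` V))) (\<lambda>V. W (insert (s m) (s ` V)))"
      unfolding class_monotone_def
    proof (intro allI impI)
      fix D x \<gamma> assume D: "D \<subseteq> {..<x}" "x < m" "Suc (card D) = Suc g"
      show "\<exists>v. \<forall>y y'. x < y \<longrightarrow> y < y' \<longrightarrow> y' < m \<longrightarrow>
             col (insert (s m) (s ` insert y D)) = \<gamma> \<longrightarrow> col (insert (s m) (s ` insert y' D)) = \<gamma> \<longrightarrow>
             W (insert (s m) (s ` insert y (insert x D))) = v \<longrightarrow>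
             W (insert (s m) (s ` insert y' (insert x D))) = v"
      \<comment> \<open>Here \<open>s m\<close> is the whole tail, so the direction is given by the
        color of \<open>D\<close>, \<open>y\<close>, \<open>y'\<close>. Replacing the last point
        \<open>y'\<close> by \<open>m\<close> does not change this color, so it is
        \<open>\<gamma>\<close>, the class of \<open>y\<close>: the direction is now known before
        \<open>y'\<close> is.\<close>
      proof (intro exI[of _ "dir \<gamma>"] allI impI)
        fix y y' assume y: "x < y" "y < y'" "y' < m"
          and g1: "col (insert (s m) (s ` insert y D)) = \<gamma>"
          and W: "W (insert (s m) (s ` insert y (insert x D))) = dir \<gamma>"
        have fin: "finite D" using D(1) by (rule finite_subset) simp
        have "card (insert y D) = Suc g" using D y fin by (subst card_insert_disjoint) auto
        moreover have "insert y D \<subseteq> {..<m}" "insert y D \<subseteq> {..<y'}" using D y by auto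
        ultimately have "col (insert (s y') (s ` insert y D)) = \<gamma>"
          using hom[of "insert y D" m y'] g1 y by simp
        then have "col (insert (s y) (insert (s y') (s ` D))) = \<gamma>" by (simp add: insert_commute)
        then show "W (insert (s m) (s ` insert y' (insert x D))) = dir \<gamma>"
          using step[OF D(1) y(1,2), of "{}"] y(3) 0 D W by (auto simp: insert_commute)
      qed
    qed
    then show ?thesis using Suc 0 unfolding deferred_monotone_def by simp
  next
    case (Suc e1)
    have "\<exists>dir. \<forall>D x y y' E. D \<subseteq> {..<x} \<longrightarrow> x < y \<longrightarrow> y < y' \<longrightarrow> E \<subseteq> {y'<..<m} \<longrightarrow>
        card E = e \<longrightarrow> Suc (card D + card E) = Suc g \<longrightarrow>
        (\<exists>e\<in>E. W (insert (s m) (s ` (insert x (insert y (D \<union> E))))) = dir (col (insert (s m) (s ` (insert y (insert y' (D \<union> (E - {e}))))))) \<longrightarrow>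
               W (insert (s m) (s ` (insert x (insert y' (D \<union> E))))) = dir (col (insert (s m) (s ` (insert y (insert y' (D \<union> (E - {e}))))))))"
    proof (intro exI[of _ dir] allI impI)
      fix D x y y' E
      assume D: "D \<subseteq> {..<x}" "x < y" "y < y'" "E \<subseteq> {y'<..<m}" "card E = e" "Suc (card D + card E) = Suc g"
      have ne: "E \<noteq> {}" using D(5) Suc by auto
      have fin: "finite D" "finite E" using D(1,4) by (auto intro: finite_subset)
      have y'm: "y' < m" using D(4) ne by fastforce
      have sub: "E \<subseteq> {..<Suc m}" using D by auto
      from step[OF D(1-4) y'm D(5,6)] obtain e' where e': "e' = s m \<or> e' \<in> s ` E"
        "W (insert (s m) (s ` insert x (insert y (D \<union> E)))) =
         dir (col (insert (s y) (insert (s y') (s ` D \<union> (insert (s m) (s ` E) - {e'}))))) \<longrightarrow>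
         W (insert (s m) (s ` insert x (insert y' (D \<union> E)))) =
         dir (col (insert (s y) (insert (s y') (s ` D \<union> (insert (s m) (s ` E) - {e'})))))" by blast
      have "\<exists>f\<in>E. col (insert (s y) (insert (s y') (s ` D \<union> (insert (s m) (s ` E) - {e'})))) =
          col (insert (s m) (s ` insert y (insert y' (D \<union> (E - {f})))))"
      proof (cases "e' = s m")
        case True
        \<comment> \<open>The element left out is \<open>s m\<close>, so the color in question ends
          in \<open>s ?f\<close>. Exchanging this last point for \<open>s m\<close> preserves the
          color and amounts to leaving out \<open>?f\<close> instead.\<close>
        let ?f = "Max E"
        have f: "?f \<in> E" using ne fin by simp
        let ?V = "insert y (insert y' (D \<union> (E - {?f})))"
        have smE: "s m \<notin> s ` E"
        proof
          assume "s m \<in> s ` E"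
          then obtain z where "z \<in> E" "s z = s m" by auto
          then show False using less[of z m] D(4) by auto
        qed
        have "E - {?f} \<subseteq> {..<?f}" using fin by (auto simp: less_le)
        moreover have "y' < ?f" "?f < m" using f D(4) by auto
        ultimately have sV: "?V \<subseteq> {..<?f}" "?V \<subseteq> {..<m}" using D(1-3) by force+
        have "card (insert y' (D \<union> (E - {?f}))) = Suc (card (D \<union> (E - {?f})))"
          using fin D by (intro card_insert_disjoint) auto
        moreover have "card (D \<union> (E - {?f})) = card D + card (E - {?f})"
          using fin D by (intro card_Un_disjoint) force+
        moreover have "card (E - {?f}) = e1" using f fin D(5) Suc by simp
        moreover have "card ?V = Suc (card (insert y' (D \<union> (E - {?f}))))"
          using fin D by (intro card_insert_disjoint) auto
        ultimately have "card ?V = Suc g" using D(5,6) Suc by simp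
        then have "col (insert (s ?f) (s ` ?V)) = col (insert (s m) (s ` ?V))"
          using hom[OF sV] \<open>?f < m\<close> by simp
        moreover have "insert (s ?f) (s ` ?V) = insert (s y) (insert (s y') (s ` D \<union> (insert (s m) (s ` E) - {e'})))"
          using f smE True by auto
        ultimately show ?thesis using f by metis
      next
        case False
        then obtain f where f: "f \<in> E" "e' = s f" using e' by auto
        have "s ` E - {s f} = s ` (E - {f})"
          using inj_on_image_set_diff[OF inj, of E "{f}"] f(1) sub by auto
        then have "insert (s y) (insert (s y') (s ` D \<union> (insert (s m) (s ` E) - {e'}))) =
          insert (s m) (s ` insert y (insert y' (D \<union> (E - {f}))))"
          using f False by auto
        then show ?thesis using f(1) by auto
      qed
      with e'(2) show "\<exists>e\<in>E. W (insert (s m) (s ` (insert x (insert y (D \<union> E))))) = dir (col (insert (s m) (s ` (insert y (insert y' (D \<union> (E - {e}))))))) \<longrightarrow>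
               W (insert (s m) (s ` (insert x (insert y' (D \<union> E))))) = dir (col (insert (s m) (s ` (insert y (insert y' (D \<union> (E - {e})))))))"
        by metis
    qed
    then show ?thesis using \<open>d = Suc e\<close> Suc unfolding deferred_monotone_def by simp
  qed
qed

section \<open>Ramsey theorem for eventually monotone predicates\<close>

lemma initial_segment:
  fixes R :: "nat set"
  assumes "finite R" "n \<le> card R"
  shows "\<exists>B\<subseteq>R. card B = n \<and> (\<forall>x\<in>B. \<forall>y\<in>R - B. x < y)"
  using assms(2)
proof (induction n)
  case 0
  show ?case by (rule exI[of _ "{}"]) simp
next
  case (Suc n)
  then obtain B where B: "B \<subseteq> R" "card B = n" "\<forall>x\<in>B. \<forall>y\<in>R - B. x < y" by auto
  have fB: "finite B" using B(1) assms(1) finite_subset by blast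
  have ne: "R - B \<noteq> {}" using B(1,2) Suc.prems by auto
  let ?m = "Min (R - B)"
  have fin: "finite (R - B)" using assms(1) by simp
  have m: "?m \<in> R - B" "\<And>y. y \<in> R - B \<Longrightarrow> ?m \<le> y"
    using Min_in[OF fin ne] Min_le[OF fin] by blast+
  have "card (insert ?m B) = Suc n" using m(1) B(2) fB by simp
  moreover have "x < y" if "x \<in> insert ?m B" "y \<in> R - insert ?m B" for x y
    using that B(3) m(2)[of y] by (auto simp: less_le)
  ultimately show ?case using m(1) B(1) by (intro exI[of _ "insert ?m B"]) auto
qed

text \<open>Cut \<open>R\<close> into \<open>m\<close> consecutive blocks of size \<open>n\<close>.
  Either some block contains no pair in \<open>Q\<close>, or each block contains some
  \<open>x\<close> and \<open>y\<close> with \<open>Q x y\<close>; by persistence such an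
  \<open>x\<close> is related to every point of all later blocks, and these \<open>m\<close> points
  form the second set.\<close>

lemma homogeneous_block:
  fixes R :: "nat set" and Q :: "nat \<Rightarrow> nat \<Rightarrow> bool"
  assumes "finite R" "m * n \<le> card R"
    and "\<And>x y y'. x \<in> R \<Longrightarrow> y \<in> R \<Longrightarrow> y' \<in> R \<Longrightarrow> x < y \<Longrightarrow> y < y' \<Longrightarrow> Q x y \<Longrightarrow> Q x y'"
  shows "(\<exists>S\<subseteq>R. card S = n \<and> (\<forall>x\<in>S. \<forall>y\<in>S. x < y \<longrightarrow> \<not> Q x y)) \<or>
         (\<exists>S\<subseteq>R. card S = m \<and> (\<forall>x\<in>S. \<forall>y\<in>S. x < y \<longrightarrow> Q x y))"
  using assms
proof (induction m arbitrary: R)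
  case 0
  have "(\<exists>S\<subseteq>R. card S = 0 \<and> (\<forall>x\<in>S. \<forall>y\<in>S. x < y \<longrightarrow> Q x y))" by (rule exI[of _ "{}"]) simp
  then show ?case by blast
next
  case (Suc m)
  from initial_segment[OF Suc.prems(1), of n] Suc.prems(2)
  obtain B where B: "B \<subseteq> R" "card B = n" "\<forall>x\<in>B. \<forall>y\<in>R - B. x < y" by auto
  show ?case
  proof (cases "\<exists>x\<in>B. \<exists>y\<in>B. x < y \<and> Q x y")
    case False
    then show ?thesis using B(1,2) by blast
  next
    case True
    then obtain x y where xy: "x \<in> B" "y \<in> B" "x < y" "Q x y" by blast
    have fB: "finite B" using B(1) Suc.prems(1) finite_subset by blast
    have "m * n \<le> card (R - B)" using Suc.prems(2) B(1,2) fB by (simp add: card_Diff_subset)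
    have "(\<exists>S\<subseteq>R - B. card S = n \<and> (\<forall>x\<in>S. \<forall>y\<in>S. x < y \<longrightarrow> \<not> Q x y)) \<or>
         (\<exists>S\<subseteq>R - B. card S = m \<and> (\<forall>x\<in>S. \<forall>y\<in>S. x < y \<longrightarrow> Q x y))"
    proof (rule Suc.IH[OF _ \<open>m * n \<le> card (R - B)\<close>])
      show "finite (R - B)" using Suc.prems(1) by simp
      show "Q x y'" if "x \<in> R - B" "y \<in> R - B" "y' \<in> R - B" "x < y" "y < y'" "Q x y" for x y y'
        using that by (intro Suc.prems(3)[of x y y']) auto
    qed
    then consider S where "S \<subseteq> R - B" "card S = n" "\<forall>x\<in>S. \<forall>y\<in>S. x < y \<longrightarrow> \<not> Q x y"
      | S where "S \<subseteq> R - B" "card S = m" "\<forall>x\<in>S. \<forall>y\<in>S. x < y \<longrightarrow> Q x y"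
      by (elim disjE exE conjE) auto
    then show ?thesis
    proof cases
      case 1
      then show ?thesis by blast
    next
      case 2
      have xS: "x \<notin> S" "finite S" using 2(1) xy(1) Suc.prems(1) finite_subset by auto
      have gt: "x < z \<and> Q x z" if "z \<in> S" for z
      proof
        have z: "z \<in> R - B" using 2(1) that by blast
        show "x < z" using B(3) xy(1) z by blast
        have "y < z" using B(3) xy(2) z by blast
        then show "Q x z" using Suc.prems(3)[of x y z] xy B(1) z by blast
      qed
      have "card (insert x S) = Suc m" using xS 2(2) by simp
      moreover have "\<forall>u\<in>insert x S. \<forall>z\<in>insert x S. u < z \<longrightarrow> Q u z"
        using gt 2(3) less_asym by blast
      moreover have "insert x S \<subseteq> R" using 2(1) xy(1) B(1) by blast
      ultimately show ?thesis by blast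
    qed
  qed
qed

text \<open>The persisting value may vary with \<open>x\<close>. Making it constant costs the factor
  2, and the blocks then need \<open>n * n\<close> points.\<close>

lemma monotone_pairs:
  fixes R :: "nat set" and W :: "nat set \<Rightarrow> bool"
  assumes "finite R" "2 * n\<^sup>2 \<le> card R"
    and mono: "\<And>x. x \<in> R \<Longrightarrow> \<exists>v. \<forall>y\<in>R. \<forall>y'\<in>R. x < y \<longrightarrow> y < y' \<longrightarrow> W {x, y} = v \<longrightarrow> W {x, y'} = v"
  shows "\<exists>S\<subseteq>R. card S = n \<and> (\<exists>c. \<forall>x\<in>S. \<forall>y\<in>S. x < y \<longrightarrow> W {x, y} = c)"
proof -
  obtain v where v: "\<And>x y y'. x \<in> R \<Longrightarrow> y \<in> R \<Longrightarrow> y' \<in> R \<Longrightarrow> x < y \<Longrightarrow> y < y' \<Longrightarrow> W {x, y} = v x \<Longrightarrow> W {x, y'} = v x"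
    using mono by metis
  have "card (v ` R) \<le> card (UNIV :: bool set)" by (rule card_mono) auto
  then have "card (v ` R) \<le> 2" by simp
  from pigeonhole_fibre[OF assms(1) this] obtain t where t: "card R \<le> card {x \<in> R. v x = t} * 2" by blast
  let ?R = "{x \<in> R. v x = t}"
  have 1: "finite ?R" "n * n \<le> card ?R" using assms(1,2) t by (auto simp: power2_eq_square)
  have 2: "W {x, y'} = t" if "x \<in> ?R" "y \<in> ?R" "y' \<in> ?R" "x < y" "y < y'" "W {x, y} = t" for x y y'
    using v[of x y y'] that by auto
  from homogeneous_block[OF 1, of "\<lambda>x y. W {x, y} = t", OF 2]
  have "(\<exists>S\<subseteq>?R. card S = n \<and> (\<forall>x\<in>S. \<forall>y\<in>S. x < y \<longrightarrow> W {x, y} = (\<not> t))) \<or>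
        (\<exists>S\<subseteq>?R. card S = n \<and> (\<forall>x\<in>S. \<forall>y\<in>S. x < y \<longrightarrow> W {x, y} = t))" by simp
  then show ?thesis
  proof
    assume "\<exists>S\<subseteq>?R. card S = n \<and> (\<forall>x\<in>S. \<forall>y\<in>S. x < y \<longrightarrow> W {x, y} = (\<not> t))"
    then obtain S where "S \<subseteq> ?R" "card S = n" "\<forall>x\<in>S. \<forall>y\<in>S. x < y \<longrightarrow> W {x, y} = (\<not> t)" by blast
    then show ?thesis by (intro exI[of _ S] conjI exI[of _ "\<not> t"]) auto
  next
    assume "\<exists>S\<subseteq>?R. card S = n \<and> (\<forall>x\<in>S. \<forall>y\<in>S. x < y \<longrightarrow> W {x, y} = t)"
    then obtain S where "S \<subseteq> ?R" "card S = n" "\<forall>x\<in>S. \<forall>y\<in>S. x < y \<longrightarrow> W {x, y} = t" by blast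
    then show ?thesis by (intro exI[of _ S] conjI exI[of _ t]) auto
  qed
qed

text \<open>Monotonicity is inherited by subsets, so the predicates can be treated one after
  another. As \<open>2 * n\<^sup>2 \<le> n ^ 3\<close> for \<open>2 \<le> n\<close>, each of them
  triples the exponent.\<close>

lemma monotone_pairs_family:
  fixes W :: "'a \<Rightarrow> nat set \<Rightarrow> bool"
  assumes "finite A" "2 \<le> n" "finite R" "n ^ (3 ^ card A) \<le> card R"
    and "\<And>a x. a \<in> A \<Longrightarrow> x \<in> R \<Longrightarrow>
      \<exists>v. \<forall>y\<in>R. \<forall>y'\<in>R. x < y \<longrightarrow> y < y' \<longrightarrow> W a {x, y} = v \<longrightarrow> W a {x, y'} = v"
  shows "\<exists>S\<subseteq>R. card S = n \<and> (\<forall>a\<in>A. \<exists>c. \<forall>x\<in>S. \<forall>y\<in>S. x < y \<longrightarrow> W a {x, y} = c)"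
  using assms(1,3-)
proof (induction A arbitrary: R rule: finite_induct)
  case empty
  then show ?case using initial_segment[of R n] by auto
next
  case (insert a A)
  let ?n = "n ^ (3 ^ card A)"
  have "2 ^ 1 \<le> ?n" using assms(2) by (intro order_trans[OF power_increasing[of 1 "3 ^ card A" 2] power_mono]) auto
  then have "2 * ?n\<^sup>2 \<le> ?n * ?n\<^sup>2" by (intro mult_le_mono1) simp
  also have "\<dots> = n ^ (3 ^ card (insert a A))"
    using insert.hyps by (simp add: mult.commute[of 3] power_mult power3_eq_cube power2_eq_square)
  also have "\<dots> \<le> card R" by (rule insert.prems)
  finally have le: "2 * ?n\<^sup>2 \<le> card R" .
  have "\<exists>S\<subseteq>R. card S = ?n \<and> (\<exists>c. \<forall>x\<in>S. \<forall>y\<in>S. x < y \<longrightarrow> W a {x, y} = c)"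
    by (rule monotone_pairs[OF insert.prems(1) le insert.prems(3)[OF insertI1]])
  then obtain S c where S: "S \<subseteq> R" "card S = ?n" "\<forall>x\<in>S. \<forall>y\<in>S. x < y \<longrightarrow> W a {x, y} = c"
    by (elim exE conjE) (rule that)
  have "\<exists>v. \<forall>y\<in>S. \<forall>y'\<in>S. x < y \<longrightarrow> y < y' \<longrightarrow> W b {x, y} = v \<longrightarrow> W b {x, y'} = v"
    if "b \<in> A" "x \<in> S" for b x
  proof -
    from insert.prems(3)[OF insertI2[OF that(1)] subsetD[OF S(1) that(2)]] obtain v
      where v: "\<forall>y\<in>R. \<forall>y'\<in>R. x < y \<longrightarrow> y < y' \<longrightarrow> W b {x, y} = v \<longrightarrow> W b {x, y'} = v"
      by (elim exE) (rule that)
    show ?thesis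
      by (intro exI[of _ v] ballI) (rule v[THEN bspec, THEN bspec, OF subsetD[OF S(1)] subsetD[OF S(1)]])
  qed
  then have "\<exists>T\<subseteq>S. card T = n \<and> (\<forall>a\<in>A. \<exists>c. \<forall>x\<in>T. \<forall>y\<in>T. x < y \<longrightarrow> W a {x, y} = c)"
    by (rule insert.IH[OF finite_subset[OF S(1) insert.prems(1)] eq_refl[OF S(2)[symmetric]]])
  then obtain T where T: "T \<subseteq> S" "card T = n" "\<forall>a\<in>A. \<exists>c. \<forall>x\<in>T. \<forall>y\<in>T. x < y \<longrightarrow> W a {x, y} = c"
    by (elim exE conjE) (rule that)
  have "\<exists>c. \<forall>x\<in>T. \<forall>y\<in>T. x < y \<longrightarrow> W a {x, y} = c"
    by (intro exI[of _ c] ballI) (rule S(3)[THEN bspec, THEN bspec, OF subsetD[OF T(1)] subsetD[OF T(1)]])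
  with T(3) have "\<forall>b\<in>insert a A. \<exists>c. \<forall>x\<in>T. \<forall>y\<in>T. x < y \<longrightarrow> W b {x, y} = c" by simp
  with T(1,2) S(1) show ?case by (intro exI[of _ T] conjI) (rule order_trans)
qed

lemma nsets_Suc_Max:
  fixes S :: "nat set"
  assumes "U \<in> nsets S (Suc h)"
  obtains D y where "D \<in> nsets S h" "y \<in> S" "D \<subseteq> {..<y}" "U = insert y D"
proof -
  have U: "U \<subseteq> S" "finite U" "card U = Suc h" using assms by (auto simp: nsets_def)
  then have M: "Max U \<in> U" by (intro Max_in) auto
  have "U - {Max U} \<in> nsets S h" using U M by (auto simp: nsets_def)
  moreover have "U - {Max U} \<subseteq> {..<Max U}" using U by (auto simp: less_le)
  ultimately show ?thesis using that[of "U - {Max U}" "Max U"] M U by auto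
qed


text \<open>Here \<open>M ^ K\<close> will serve as \<open>L\<close> and \<open>K * M\<close> as
  \<open>lg\<close>; the crude bound \<open>Suc M \<le> 2 ^ M\<close> is good enough because the
  type length may be any polynomial in \<open>M\<close>. The exponent \<open>K\<close> occurs on
  both sides of the second inequality, but only linearly on the left, so a large \<open>K\<close>
  satisfies it.\<close>

lemma ex_scale_exponent:
  fixes p q h :: nat
  shows "\<exists>K\<ge>1. \<forall>M\<ge>2. Suc (M ^ K) \<le> 2 ^ (K * M) \<and>
     M\<^sup>2 * (M ^ Suc h * (p + q * (K * M + 2)) + 1) \<le> M ^ K"
proof -
  define B where "B = p + q * (h + 6) + 1"
  define t where "t = B + q"
  define K where "K = h + 4 + 3 * t"
  have "Suc t \<le> 2 ^ t" by (simp add: Suc_le_eq)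
  then have "Suc t ^ 3 \<le> (2 ^ t) ^ 3" by (rule power_mono) simp
  also have "\<dots> = 2 ^ (3 * t)" by (simp add: mult.commute flip: power_mult)
  finally have 1: "Suc t ^ 3 \<le> 2 ^ (3 * t)" .
  have "q * t \<le> t * t" unfolding t_def by (rule mult_le_mono1) simp
  moreover have "Suc t ^ 3 = t * t * t + 3 * (t * t) + 3 * t + 1" by (simp add: power3_eq_cube algebra_simps)
  moreover have "B \<le> 3 * t" unfolding t_def by simp
  ultimately have "B + 3 * (q * t) \<le> Suc t ^ 3" by linarith
  also have "\<dots> \<le> 2 ^ (3 * t)" by (rule 1)
  also have "B + 3 * (q * t) = p + q * (K + 2) + 1" unfolding B_def K_def by (simp add: algebra_simps)
  finally have K: "p + q * (K + 2) + 1 \<le> 2 ^ (3 * t)" .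
  have "Suc (M ^ K) \<le> 2 ^ (K * M) \<and> M\<^sup>2 * (M ^ Suc h * (p + q * (K * M + 2)) + 1) \<le> M ^ K" if M: "2 \<le> M" for M
  proof
    have "M ^ K < Suc M ^ K" unfolding K_def by (intro power_strict_mono) auto
    also have "\<dots> \<le> (2 ^ M) ^ K" by (rule power_mono) (simp_all add: Suc_le_eq)
    also have "\<dots> = 2 ^ (K * M)" by (simp add: mult.commute flip: power_mult)
    finally show "Suc (M ^ K) \<le> 2 ^ (K * M)" by simp
    have "p + q * (K * M + 2) \<le> M * (p + q * (K + 2))"
    proof -
      have "1 * (p + 2 * q) \<le> M * (p + 2 * q)" using M by (intro mult_le_mono1) simp
      then show ?thesis by (simp add: algebra_simps)
    qed
    then have "M ^ Suc h * (p + q * (K * M + 2)) + 1 \<le> M ^ Suc h * (M * (p + q * (K + 2))) + M ^ Suc h * M"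
      using M by (intro add_mono mult_le_mono2) (auto simp: Suc_le_eq)
    also have "\<dots> = M ^ (h + 2) * (p + q * (K + 2) + 1)" by (simp add: algebra_simps)
    finally have "M\<^sup>2 * (M ^ Suc h * (p + q * (K * M + 2)) + 1) \<le> M\<^sup>2 * (M ^ (h + 2) * (p + q * (K + 2) + 1))"
      by (rule mult_le_mono2)
    also have "\<dots> = M ^ (h + 4) * (p + q * (K + 2) + 1)" by (simp add: power_add power2_eq_square power4_eq_xxxx algebra_simps)
    also have "\<dots> \<le> M ^ (h + 4) * M ^ (3 * t)"
      using K M by (intro mult_le_mono2) (meson order_trans power_mono zero_le)
    also have "\<dots> = M ^ K" unfolding K_def by (simp add: power_add)
    finally show "M\<^sup>2 * (M ^ Suc h * (p + q * (K * M + 2)) + 1) \<le> M ^ K" .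
  qed
  moreover have "1 \<le> K" unfolding K_def by simp
  ultimately show ?thesis by blast
qed

text \<open>The points are restricted to one color class, which costs a factor
  \<open>2 ^ p \<le> n ^ p\<close>. Within the class, \<open>class_monotone\<close> with empty
  \<open>D\<close> is plain monotonicity in the larger point.\<close>

lemma monotone_ramsey_base:
  fixes col :: "nat set \<Rightarrow> 'c" and W :: "'a \<Rightarrow> nat set \<Rightarrow> bool"
  assumes n: "2 \<le> n" and Col: "finite Col" "card Col \<le> 2 ^ p" and A: "finite A" "card A \<le> q"
    and N: "n ^ (p + 3 ^ q) \<le> N"
    and col: "\<And>V. V \<in> nsets {..<N} 1 \<Longrightarrow> col V \<in> Col" and W: "\<And>a. a \<in> A \<Longrightarrow> class_monotone N 1 col (W a)"
  shows "\<exists>S\<subseteq>{..<N}. card S = n \<and> (\<forall>V\<in>nsets S 1. \<forall>V'\<in>nsets S 1. col V = col V') \<and>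
     (\<forall>a\<in>A. \<forall>V\<in>nsets S 2. \<forall>V'\<in>nsets S 2. W a V = W a V')"
proof -
  have "(\<lambda>x. col {x}) ` {..<N} \<subseteq> Col" using col by (auto simp: nsets_def)
  then have "card ((\<lambda>x. col {x}) ` {..<N}) \<le> 2 ^ p" using Col by (meson card_mono order_trans)
  from pigeonhole_fibre[OF finite_lessThan this] obtain t
    where t: "N \<le> card {x \<in> {..<N}. col {x} = t} * 2 ^ p" by auto
  define R where "R = {x \<in> {..<N}. col {x} = t}"
  have "finite R" "R \<subseteq> {..<N}" unfolding R_def by auto
  have "2 ^ p * n ^ (3 ^ q) \<le> n ^ p * n ^ (3 ^ q)" using n by (intro mult_le_mono1 power_mono) auto
  also have "\<dots> \<le> card R * 2 ^ p" using N t unfolding R_def by (simp add: power_add)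
  finally have "n ^ (3 ^ q) \<le> card R" by simp
  moreover have "n ^ (3 ^ card A) \<le> n ^ (3 ^ q)" using n A by (intro power_increasing) auto
  ultimately have cR: "n ^ (3 ^ card A) \<le> card R" by simp
  have "\<exists>v. \<forall>y\<in>R. \<forall>y'\<in>R. x < y \<longrightarrow> y < y' \<longrightarrow> W a {x, y} = v \<longrightarrow> W a {x, y'} = v"
    if "a \<in> A" "x \<in> R" for a x
  proof -
    have "\<exists>v. \<forall>y y'. x < y \<longrightarrow> y < y' \<longrightarrow> y' < N \<longrightarrow> col {y} = t \<longrightarrow> col {y'} = t \<longrightarrow>
           W a {y, x} = v \<longrightarrow> W a {y', x} = v"
      using W[OF that(1), unfolded class_monotone_def, THEN spec[of _ "{}"], THEN spec[of _ x], THEN spec[of _ t]] that(2)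
      unfolding R_def by simp
    then obtain v where v: "\<forall>y y'. x < y \<longrightarrow> y < y' \<longrightarrow> y' < N \<longrightarrow> col {y} = t \<longrightarrow> col {y'} = t \<longrightarrow>
           W a {y, x} = v \<longrightarrow> W a {y', x} = v" by (elim exE) (rule that)
    show ?thesis
    proof (intro exI[of _ v] ballI impI)
      fix y y' assume "y \<in> R" "y' \<in> R" "x < y" "y < y'" "W a {x, y} = v"
      then show "W a {x, y'} = v"
        using v[THEN spec[of _ y], THEN spec[of _ y']] unfolding R_def by (simp add: insert_commute)
    qed
  qed
  then have "\<exists>S\<subseteq>R. card S = n \<and> (\<forall>a\<in>A. \<exists>c. \<forall>x\<in>S. \<forall>y\<in>S. x < y \<longrightarrow> W a {x, y} = c)"
    by (rule monotone_pairs_family[OF A(1) n \<open>finite R\<close> cR])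
  then obtain S where S: "S \<subseteq> R" "card S = n" "\<forall>a\<in>A. \<exists>c. \<forall>x\<in>S. \<forall>y\<in>S. x < y \<longrightarrow> W a {x, y} = c"
    by (elim exE conjE) (rule that)
  have "col V = t" if "V \<in> nsets S 1" for V
    using that S(1) unfolding R_def nsets_def by (auto simp: card_1_singleton_iff)
  then have 1: "\<forall>V\<in>nsets S 1. \<forall>V'\<in>nsets S 1. col V = col V'" by simp
  have 2: "W a V = W a V'" if a: "a \<in> A" and V: "V \<in> nsets S 2" "V' \<in> nsets S 2" for a V V'
  proof -
    from S(3)[THEN bspec, OF a] obtain c where c: "\<forall>x\<in>S. \<forall>y\<in>S. x < y \<longrightarrow> W a {x, y} = c"
      by (elim exE) (rule that)
    have "W a V = c" if V: "V \<in> nsets S 2" for V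
    proof -
      from V have "V \<in> nsets S (Suc (Suc 0))" by (simp add: numeral_2_eq_2)
      then obtain D y where D: "D \<in> nsets S (Suc 0)" "y \<in> S" "D \<subseteq> {..<y}" "V = insert y D"
        by (rule nsets_Suc_Max)
      then obtain x where "D = {x}" by (auto simp: nsets_def card_1_singleton_iff)
      then show ?thesis using c D by (auto simp: nsets_def insert_commute)
    qed
    then show ?thesis using V by simp
  qed
  show ?thesis
  proof (intro exI[of _ S] conjI ballI)
    show "S \<subseteq> {..<N}" using S(1) \<open>R \<subseteq> {..<N}\<close> by (rule order_trans)
    show "card S = n" by (rule S(2))
    show "col V = col V'" if "V \<in> nsets S 1" "V' \<in> nsets S 1" for V V'
      using 1 that by blast
    show "W a V = W a V'" if "a \<in> A" "V \<in> nsets S 2" "V' \<in> nsets S 2" for a V V'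
      using that by (rule 2)
  qed
qed

text \<open>Each round lowers both arities, and every positive \<open>d a\<close>, by one at the
  cost of one exponential. The bound \<open>d a \<le> h\<close> thus ensures that no direction is
  still deferred when the base case is reached. The color and all predicates must share the same
  rounds, because the directions are read off from colors.\<close>

theorem monotone_ramsey:
  fixes p q h :: nat
  shows "\<exists>C\<ge>1. \<forall>n N (col :: nat set \<Rightarrow> 'c) (W :: 'a \<Rightarrow> nat set \<Rightarrow> bool) Col A d.
     2 \<le> n \<longrightarrow> finite Col \<longrightarrow> card Col \<le> 2 ^ p \<longrightarrow> Col \<noteq> {} \<longrightarrow> finite A \<longrightarrow> card A \<le> q \<longrightarrow>
     tw h (n ^ C) \<le> N \<longrightarrow> (\<forall>V\<in>nsets {..<N} (Suc h). col V \<in> Col) \<longrightarrow>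
     (\<forall>a\<in>A. d a \<le> h \<and> deferred_monotone (d a) N (Suc h) col (W a)) \<longrightarrow>
     (\<exists>S\<subseteq>{..<N}. card S = n \<and> (\<forall>V\<in>nsets S (Suc h). \<forall>V'\<in>nsets S (Suc h). col V = col V') \<and>
       (\<forall>a\<in>A. \<forall>V\<in>nsets S (Suc (Suc h)). \<forall>V'\<in>nsets S (Suc (Suc h)). W a V = W a V'))"
proof (induction h)
  case 0
  show ?case
  proof (intro exI[of _ "p + 3 ^ q"] conjI allI impI)
    show "1 \<le> p + 3 ^ q" by (simp add: le_SucI Suc_le_eq)
    fix n N Col A d and col :: "nat set \<Rightarrow> 'c" and W :: "'a \<Rightarrow> nat set \<Rightarrow> bool"
    assume *: "2 \<le> n" "finite Col" "card Col \<le> 2 ^ p" "finite A" "card A \<le> q"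
       "tw 0 (n ^ (p + 3 ^ q)) \<le> N" "\<forall>V\<in>nsets {..<N} (Suc 0). col V \<in> Col"
       "\<forall>a\<in>A. d a \<le> 0 \<and> deferred_monotone (d a) N (Suc 0) col (W a)"
    have "class_monotone N 1 col (W a)" if "a \<in> A" for a using *(8) that unfolding deferred_monotone_def by auto
    from monotone_ramsey_base[where A = A and W = W, OF *(1-5) _ _ this] *(6,7)
    show "\<exists>S\<subseteq>{..<N}. card S = n \<and> (\<forall>V\<in>nsets S (Suc 0). \<forall>V'\<in>nsets S (Suc 0). col V = col V') \<and>
       (\<forall>a\<in>A. \<forall>V\<in>nsets S (Suc (Suc 0)). \<forall>V'\<in>nsets S (Suc (Suc 0)). W a V = W a V')"
      by (simp add: numeral_2_eq_2)
  qed
next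
  case (Suc g)
  then obtain C where C: "1 \<le> C" and IH: "\<And>n N (col :: nat set \<Rightarrow> 'c) (W :: 'a \<Rightarrow> nat set \<Rightarrow> bool) Col A d.
     2 \<le> n \<Longrightarrow> finite Col \<Longrightarrow> card Col \<le> 2 ^ p \<Longrightarrow> Col \<noteq> {} \<Longrightarrow> finite A \<Longrightarrow> card A \<le> q \<Longrightarrow>
     tw g (n ^ C) \<le> N \<Longrightarrow> (\<forall>V\<in>nsets {..<N} (Suc g). col V \<in> Col) \<Longrightarrow>
     (\<forall>a\<in>A. d a \<le> g \<and> deferred_monotone (d a) N (Suc g) col (W a)) \<Longrightarrow>
     (\<exists>S\<subseteq>{..<N}. card S = n \<and> (\<forall>V\<in>nsets S (Suc g). \<forall>V'\<in>nsets S (Suc g). col V = col V') \<and>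
       (\<forall>a\<in>A. \<forall>V\<in>nsets S (Suc (Suc g)). \<forall>V'\<in>nsets S (Suc (Suc g)). W a V = W a V'))"
    by (elim exE conjE) (rule that, assumption, (drule spec)+, (drule mp, assumption)+, assumption)
  from ex_scale_exponent[of "Suc g" p q] obtain K where K: "1 \<le> K"
    "\<And>M. 2 \<le> M \<Longrightarrow> Suc (M ^ K) \<le> 2 ^ (K * M)"
    "\<And>M. 2 \<le> M \<Longrightarrow> M\<^sup>2 * (M ^ Suc (Suc g) * (p + q * (K * M + 2)) + 1) \<le> M ^ K" by auto
  show ?case
  \<comment> \<open>The round must deliver \<open>Suc m\<close> points, at a cost of
    \<open>2 ^ (Suc m ^ K)\<close>, where \<open>m\<close> is what the smaller arity requires. The
    factor 2 comes from \<open>Suc m \<le> m\<^sup>2\<close>.\<close>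
  proof (intro exI[of _ "C * (2 * K)"] conjI allI impI)
    show "1 \<le> C * (2 * K)" using C K(1) by (simp add: Suc_le_eq)
    fix n N Col A d and col :: "nat set \<Rightarrow> 'c" and W :: "'a \<Rightarrow> nat set \<Rightarrow> bool"
    assume n: "2 \<le> n" and Col: "finite Col" "card Col \<le> 2 ^ p" "Col \<noteq> {}" and A: "finite A" "card A \<le> q"
       and N: "tw (Suc g) (n ^ (C * (2 * K))) \<le> N" and col: "\<forall>V\<in>nsets {..<N} (Suc (Suc g)). col V \<in> Col"
       and W: "\<forall>a\<in>A. d a \<le> Suc g \<and> deferred_monotone (d a) N (Suc (Suc g)) col (W a)"
    define m where "m = tw g (n ^ C)"
    have "2 ^ 1 \<le> n ^ C" using n C by (intro order_trans[OF power_increasing[of 1 C 2] power_mono]) auto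
    then have n2: "2 \<le> n ^ C" by simp
    then have m2: "2 \<le> m" unfolding m_def by (rule tw_ge2)
    have "Suc m \<le> m\<^sup>2"
    proof -
      have "Suc m \<le> 2 * m" using m2 by simp
      also have "\<dots> \<le> m * m" using m2 by (rule mult_le_mono1)
      finally show ?thesis by (simp add: power2_eq_square)
    qed
    then have "Suc m ^ K \<le> (m\<^sup>2) ^ K" by (rule power_mono) simp
    also have "\<dots> = m ^ (2 * K)" by (simp add: power_mult)
    also have "\<dots> \<le> tw g ((n ^ C) ^ (2 * K))"
      unfolding m_def using n2 K(1) by (intro tw_power) auto
    finally have "2 ^ (Suc m ^ K) \<le> (2::nat) ^ tw g (n ^ (C * (2 * K)))"
      by (intro power_increasing) (simp_all add: power_mult)
    also have "\<dots> \<le> N" using N by simp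
    finally have LN: "2 ^ (Suc m ^ K) \<le> N" .
    have M2: "2 \<le> Suc m" "1 \<le> Suc m" "1 \<le> Suc g" using m2 by auto
    have "\<exists>s. strict_mono_on {..<Suc m} s \<and> s ` {..<Suc m} \<subseteq> {..<N} \<and>
     (\<forall>V z z'. V \<subseteq> {..<z} \<longrightarrow> V \<subseteq> {..<z'} \<longrightarrow> z < Suc m \<longrightarrow> z' < Suc m \<longrightarrow> card V = Suc g \<longrightarrow>
        col (insert (s z) (s ` V)) = col (insert (s z') (s ` V))) \<and>
     (\<forall>a\<in>A. \<forall>V z z'. V \<subseteq> {..<z} \<longrightarrow> V \<subseteq> {..<z'} \<longrightarrow> z < Suc m \<longrightarrow> z' < Suc m \<longrightarrow> card V = Suc (Suc g) \<longrightarrow>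
        W a (insert (s z) (s ` V)) = W a (insert (s z') (s ` V))) \<and>
     (\<forall>a\<in>A. class_monotone N (Suc (Suc g)) col (W a) \<longrightarrow>
        (\<forall>D. card D = Suc g \<longrightarrow> (\<exists>v. \<forall>b c d. D \<subseteq> {..<b} \<longrightarrow> b < c \<longrightarrow> c < d \<longrightarrow> d < Suc m \<longrightarrow>
           W a (insert (s d) (insert (s c) (s ` D))) = v \<longrightarrow>
           W a (insert (s d) (insert (s b) (s ` D))) = v)))"
      by (rule end_homogeneous[OF M2(3) Col A _ refl K(2)[OF M2(1)] K(3)[OF M2(1)] LN M2(2)]) (use col in blast)
    then obtain s where mono: "strict_mono_on {..<Suc m} s" and range: "s ` {..<Suc m} \<subseteq> {..<N}"
     and hcol: "\<forall>V z z'. V \<subseteq> {..<z} \<longrightarrow> V \<subseteq> {..<z'} \<longrightarrow> z < Suc m \<longrightarrow> z' < Suc m \<longrightarrow> card V = Suc g \<longrightarrow>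
        col (insert (s z) (s ` V)) = col (insert (s z') (s ` V))"
     and hW: "\<forall>a\<in>A. \<forall>V z z'. V \<subseteq> {..<z} \<longrightarrow> V \<subseteq> {..<z'} \<longrightarrow> z < Suc m \<longrightarrow> z' < Suc m \<longrightarrow> card V = Suc (Suc g) \<longrightarrow>
        W a (insert (s z) (s ` V)) = W a (insert (s z') (s ` V))"
     and scale: "\<forall>a\<in>A. class_monotone N (Suc (Suc g)) col (W a) \<longrightarrow>
        (\<forall>D. card D = Suc g \<longrightarrow> (\<exists>v. \<forall>b c d. D \<subseteq> {..<b} \<longrightarrow> b < c \<longrightarrow> c < d \<longrightarrow> d < Suc m \<longrightarrow>
           W a (insert (s d) (insert (s c) (s ` D))) = v \<longrightarrow>
           W a (insert (s d) (insert (s b) (s ` D))) = v))"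
      by (elim exE conjE) (rule that)
    have inj: "inj_on s {..<Suc m}" using mono by (rule strict_mono_on_imp_inj_on)
    \<comment> \<open>The extra point \<open>s m\<close> lies above all other chosen points. By
      end-homogeneity it can stand for any last argument.\<close>
    define col' where "col' = (\<lambda>V. col (insert (s m) (s ` V)))"
    define W' where "W' = (\<lambda>a V. W a (insert (s m) (s ` V)))"
    have colC: "\<forall>V\<in>nsets {..<m} (Suc g). col' V \<in> Col"
    proof
      fix V assume "V \<in> nsets {..<m} (Suc g)"
      then have V: "V \<subseteq> {..<m}" "finite V" "card V = Suc g" by (auto simp: nsets_def)
      have "m \<notin> V" using V(1) by auto
      then have "insert m V \<subseteq> {..<Suc m}" "card (insert m V) = Suc (Suc g)" using V by auto
      then have "s ` insert m V \<in> nsets {..<N} (Suc (Suc g))"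
        using range V(2) card_image[OF inj_on_subset[OF inj, of "insert m V"]]
        by (auto simp: nsets_def)
      then show "col' V \<in> Col" using col unfolding col'_def image_insert by blast
    qed
    have cms: "\<forall>a\<in>A. d a - 1 \<le> g \<and> deferred_monotone (d a - 1) m (Suc g) col' (W' a)"
    proof
      fix a assume a: "a \<in> A"
      have da: "deferred_monotone (d a) N (Suc (Suc g)) col (W a)" "d a \<le> Suc g" using W a by auto
      have "deferred_monotone (d a - 1) m (Suc g) col' (W' a)"
        unfolding col'_def W'_def
      proof (rule deferred_monotone_step[where col = col and W = "W a" and d = "d a", OF mono range _ _ da(1)])
        show "col (insert (s z) (s ` V)) = col (insert (s z') (s ` V))"
          if "V \<subseteq> {..<z}" "V \<subseteq> {..<z'}" "z < Suc m" "z' < Suc m" "card V = Suc g" for V z z'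
          by (rule hcol[rule_format, OF that])
      qed (rule scale[THEN bspec, OF a, THEN mp])
      with da(2) show "d a - 1 \<le> g \<and> deferred_monotone (d a - 1) m (Suc g) col' (W' a)" by simp
    qed
    from IH[OF n Col A _ colC cms] m_def
    obtain S where S: "S \<subseteq> {..<m}" "card S = n" "\<forall>V\<in>nsets S (Suc g). \<forall>V'\<in>nsets S (Suc g). col' V = col' V'"
       "\<forall>a\<in>A. \<forall>V\<in>nsets S (Suc (Suc g)). \<forall>V'\<in>nsets S (Suc (Suc g)). W' a V = W' a V'" by auto
    have "S \<subseteq> {..<Suc m}" using S(1) by auto
    with inj have injS: "inj_on s S" by (rule inj_on_subset)
    have decomp: "\<exists>D\<in>nsets S e. \<exists>y<m. D \<subseteq> {..<y} \<and> V = insert (s y) (s ` D)"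
      if "V \<in> nsets (s ` S) (Suc e)" for V e
    proof -
      from that obtain U where U: "U \<subseteq> S" "V = s ` U" "finite V" "card V = Suc e"
        by (auto simp: nsets_def subset_image_iff)
      have iU: "inj_on s U" using injS U(1) by (rule inj_on_subset)
      then have "U \<in> nsets S (Suc e)" using U by (auto simp: nsets_def card_image finite_image_iff)
      then obtain D y where "D \<in> nsets S e" "y \<in> S" "D \<subseteq> {..<y}" "U = insert y D" by (rule nsets_Suc_Max)
      then show ?thesis using U(2) S(1) by auto
    qed
    have c1: "\<exists>D\<in>nsets S (Suc g). col V = col' D" if "V \<in> nsets (s ` S) (Suc (Suc g))" for V
    proof -
      from decomp[OF that] obtain D y where D: "D \<in> nsets S (Suc g)" "y < m" "D \<subseteq> {..<y}" "V = insert (s y) (s ` D)"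
        by blast
      have "D \<subseteq> {..<m}" using D(2,3) by auto
      then have "col V = col' D"
        unfolding D(4) col'_def using D(1-3) by (intro hcol[rule_format]) (auto simp: nsets_def)
      then show ?thesis using D(1) by blast
    qed
    have c2: "\<exists>D\<in>nsets S (Suc (Suc g)). W a V = W' a D" if "V \<in> nsets (s ` S) (Suc (Suc (Suc g)))" "a \<in> A" for V a
    proof -
      from decomp[OF that(1)] obtain D y where D: "D \<in> nsets S (Suc (Suc g))" "y < m" "D \<subseteq> {..<y}" "V = insert (s y) (s ` D)"
        by blast
      have "D \<subseteq> {..<m}" using D(2,3) by auto
      then have "W a V = W' a D"
        unfolding D(4) W'_def using D(1-3) that(2) by (intro hW[rule_format]) (auto simp: nsets_def)
      then show ?thesis using D(1) by blast
    qed
    show "\<exists>S\<subseteq>{..<N}. card S = n \<and> (\<forall>V\<in>nsets S (Suc (Suc g)). \<forall>V'\<in>nsets S (Suc (Suc g)). col V = col V') \<and>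
       (\<forall>a\<in>A. \<forall>V\<in>nsets S (Suc (Suc (Suc g))). \<forall>V'\<in>nsets S (Suc (Suc (Suc g))). W a V = W a V')"
    proof (intro exI[of _ "s ` S"] conjI ballI)
      show "s ` S \<subseteq> {..<N}" using image_mono[OF \<open>S \<subseteq> {..<Suc m}\<close>] range by (rule order_trans)
      show "card (s ` S) = n" using card_image[OF injS] S(2) by simp
      show "col V = col V'" if "V \<in> nsets (s ` S) (Suc (Suc g))" "V' \<in> nsets (s ` S) (Suc (Suc g))" for V V'
        using c1[OF that(1)] c1[OF that(2)] S(3) by metis
      show "W a V = W a V'" if "a \<in> A" "V \<in> nsets (s ` S) (Suc (Suc (Suc g)))" "V' \<in> nsets (s ` S) (Suc (Suc (Suc g)))" for a V V'
        using c2[OF that(2,1)] c2[OF that(3,1)] S(4) that(1) by metis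
    qed
  qed
qed

section \<open>Dominance of coordinates\<close>

definition tup :: "nat \<Rightarrow> nat \<Rightarrow> (nat \<Rightarrow> nat) \<Rightarrow> bool" where
  "tup k m p \<longleftrightarrow> (\<forall>a b. a < b \<longrightarrow> b < k \<longrightarrow> p a < p b) \<and> (\<forall>a<k. p a < m)"

text \<open>What homogeneity leaves of an ordering, expressed for increasing tuples. Values of a
  tuple from index \<open>k\<close> on are arbitrary, hence \<open>ext\<close>. The names
  \<open>same\<close> and \<open>opp\<close> refer to signs, not to movements: moving
  \<open>i\<close> up and \<open>j\<close> down is a conflict between equal signs, moving both up is
  a conflict between opposite signs. The inequalities on the positions exclude moves in which one
  coordinate passes the other. The bound \<open>3 * k \<le> m\<close> gives every coordinate three
  values of its own.\<close>

locale coord_order =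
  fixes k m :: nat and lt :: "(nat \<Rightarrow> nat) \<Rightarrow> (nat \<Rightarrow> nat) \<Rightarrow> bool"
    and eps :: "nat \<Rightarrow> bool" and cs co :: "nat \<Rightarrow> nat \<Rightarrow> bool"
  assumes ext: "\<And>p p' q q'. (\<And>a. a < k \<Longrightarrow> p a = p' a) \<Longrightarrow> (\<And>a. a < k \<Longrightarrow> q a = q' a) \<Longrightarrow> lt p q \<Longrightarrow> lt p' q'"
    and trans: "\<And>p q s. tup k m p \<Longrightarrow> tup k m q \<Longrightarrow> tup k m s \<Longrightarrow> lt p q \<Longrightarrow> lt q s \<Longrightarrow> lt p s"
    and irrefl: "\<And>p. tup k m p \<Longrightarrow> \<not> lt p p"
    and total: "\<And>p q a. tup k m p \<Longrightarrow> tup k m q \<Longrightarrow> a < k \<Longrightarrow> p a \<noteq> q a \<Longrightarrow> lt p q \<or> lt q p"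
    and single: "\<And>p q i. tup k m p \<Longrightarrow> tup k m q \<Longrightarrow> i < k \<Longrightarrow> p i < q i \<Longrightarrow>
        (\<And>a. a < k \<Longrightarrow> a \<noteq> i \<Longrightarrow> p a = q a) \<Longrightarrow> lt p q = eps i"
    and same: "\<And>p q i j. tup k m p \<Longrightarrow> tup k m q \<Longrightarrow> i < j \<Longrightarrow> j < k \<Longrightarrow> p i < q i \<Longrightarrow> q i < q j \<Longrightarrow> q j < p j \<Longrightarrow>
        (\<And>a. a < k \<Longrightarrow> a \<noteq> i \<Longrightarrow> a \<noteq> j \<Longrightarrow> p a = q a) \<Longrightarrow> lt p q = cs i j"
    and opp: "\<And>p q i j. tup k m p \<Longrightarrow> tup k m q \<Longrightarrow> i < j \<Longrightarrow> j < k \<Longrightarrow> p i < q i \<Longrightarrow> q i < p j \<Longrightarrow> p j < q j \<Longrightarrow>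
        (\<And>a. a < k \<Longrightarrow> a \<noteq> i \<Longrightarrow> a \<noteq> j \<Longrightarrow> p a = q a) \<Longrightarrow> lt p q = co i j"
    and m: "3 * k \<le> m"
begin

text \<open>
  Only the moves of \<open>i\<close> and \<open>j\<close> with conflicting signs matter. They are opposite moves if the signs of the
  two coordinates agree, and parallel moves otherwise.
\<close>

definition win :: "nat \<Rightarrow> nat \<Rightarrow> bool" where
  "win i j \<longleftrightarrow> (if eps i = eps j then cs i j = eps i else co i j = eps i)"

definition dominates :: "nat \<Rightarrow> nat \<Rightarrow> bool" where
  "dominates i j \<longleftrightarrow> (if i < j then win i j else \<not> win j i)"

lemma neg: "tup k m p \<Longrightarrow> tup k m q \<Longrightarrow> a < k \<Longrightarrow> p a \<noteq> q a \<Longrightarrow> lt q p \<longleftrightarrow> \<not> lt p q"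
  using total trans irrefl by meson

text \<open>If both moves have the same effect, the tuple in which only \<open>i\<close> has moved
  lies between \<open>p\<close> and \<open>q\<close> in the ordering, and transitivity decides. If
  they conflict, the comparison is the one by which dominance is defined. The assumption
  \<open>up\<close> keeps the intermediate tuple increasing.\<close>

lemma two_step:
  assumes p: "tup k m p" and q: "tup k m q" and ij: "i < k" "j < k" "i \<noteq> j"
    and pi: "p i < q i" and pj: "p j \<noteq> q j" and eq: "\<And>a. a < k \<Longrightarrow> a \<noteq> i \<Longrightarrow> a \<noteq> j \<Longrightarrow> p a = q a"
    and up: "i < j \<Longrightarrow> q i < p j" and down: "j < i \<Longrightarrow> q j < p i" and dom: "dominates i j"
  shows "lt p q = eps i"
proof (cases "(p j < q j) = (eps i = eps j)")
  case True
  define s where "s = p(i := q i)"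
  have s: "tup k m s"
    unfolding tup_def
  proof (intro conjI allI impI)
    fix a b assume ab: "a < b" "b < k"
    have pab: "p a < p b" "q a < q b" using p q ab unfolding tup_def by auto
    consider "a = i" "b = j" | "a = i" "b \<noteq> j" | "b = i" "a \<noteq> i" | "a \<noteq> i" "b \<noteq> i" by blast
    then show "s a < s b"
    proof cases
      case 1
      then show ?thesis using up ab unfolding s_def by simp
    next
      case 2
      then show ?thesis using eq[of b] pab ab unfolding s_def by simp
    next
      case 3
      then show ?thesis using pi pab unfolding s_def by simp
    next
      case 4
      then show ?thesis using pab unfolding s_def by simp
    qed
  next
    fix a assume "a < k"
    then show "s a < m" using p q unfolding s_def tup_def by simp
  qed
  have 1: "lt p s = eps i" by (rule single[OF p s ij(1)]) (use pi in \<open>simp_all add: s_def\<close>)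
  have sq: "s a = q a" if "a < k" "a \<noteq> j" for a using eq[of a] that unfolding s_def by simp
  have sj: "s j = p j" using ij unfolding s_def by simp
  have 2: "lt s q = eps i"
  proof (cases "p j < q j")
    case pjq: True
    have "lt s q = eps j" by (rule single[OF s q ij(2)]) (use pjq sq sj in simp_all)
    then show ?thesis using True pjq by simp
  next
    case pjq: False
    have "lt q s = eps j" by (rule single[OF q s ij(2)]) (use pjq pj sq sj in simp_all)
    moreover have "lt q s \<longleftrightarrow> \<not> lt s q" using neg[OF s q ij(2)] sj pj by simp
    ultimately show ?thesis using True pjq by auto
  qed
  have "s i \<noteq> p i" using pi unfolding s_def by simp
  note n1 = neg[OF p s ij(1) this[symmetric]] and n2 = neg[OF s q ij(2)] and n3 = neg[OF p q ij(1)]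
  show ?thesis
  proof (cases "eps i")
    case True
    then show ?thesis using trans[OF p s q] 1 2 by simp
  next
    case False
    then have "lt q p" using trans[OF q s p] 1 2 n1 n2 sj pj by simp
    then show ?thesis using n3 pi False by simp
  qed
next
  case False
  show ?thesis
  proof (cases "i < j")
    case ij': True
    have w: "win i j" using dom ij' unfolding dominates_def by simp
    have qj: "q i < q j" using q ij' ij unfolding tup_def by simp
    show ?thesis
    proof (cases "eps i = eps j")
      case True
      then have "q j < p j" using False pj by simp
      then have "lt p q = cs i j" using same[OF p q ij' ij(2) pi qj] eq by simp
      then show ?thesis using w True unfolding win_def by simp
    next
      case neq: False
      then have "p j < q j" using False by simp
      then have "lt p q = co i j" using opp[OF p q ij' ij(2) pi up[OF ij']] eq by simp
      then show ?thesis using w neq unfolding win_def by simp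
    qed
  next
    case ij': False
    then have ji: "j < i" using ij by simp
    have w: "\<not> win j i" using dom ij' unfolding dominates_def by simp
    show ?thesis
    proof (cases "eps i = eps j")
      case True
      then have qp: "q j < p j" using False pj by simp
      have "p j < p i" using p ji ij unfolding tup_def by simp
      then have "lt q p = cs j i" using same[OF q p ji ij(1) qp _ pi] eq by simp
      then show ?thesis using w True neg[OF p q ij(1)] pi unfolding win_def by auto
    next
      case neq: False
      then have "p j < q j" using False by simp
      then have "lt p q = co j i" using opp[OF p q ji ij(1) _ down[OF ji] pi] eq by simp
      then show ?thesis using w neq unfolding win_def by auto
    qed
  qed
qed

lemma two_step_up:
  assumes p: "tup k m p" and q: "tup k m q" and ij: "i < k" "j < k" "i \<noteq> j"
    and pi: "p i \<noteq> q i" "(p i < q i) = eps i" and pj: "p j \<noteq> q j"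
    and eq: "\<And>a. a < k \<Longrightarrow> a \<noteq> i \<Longrightarrow> a \<noteq> j \<Longrightarrow> p a = q a"
    and up: "i < j \<Longrightarrow> q i < p j \<and> p i < q j" and down: "j < i \<Longrightarrow> q j < p i \<and> p j < q i" and dom: "dominates i j"
  shows "lt p q"
proof (cases "eps i")
  case True
  then show ?thesis using two_step[OF p q ij _ pj eq] pi up down dom by simp
next
  case False
  then have "q i < p i" using pi by simp
  then have "\<not> lt q p"
    using two_step[OF q p ij _ pj[symmetric] eq[symmetric]] up down dom False by simp
  then show ?thesis using neg[OF p q ij(1) pi(1)] by simp
qed

lemma dominates_trans:
  assumes "i < k" "j < k" "l < k" "i \<noteq> j" "j \<noteq> l" "i \<noteq> l" "dominates i j" "dominates j l"
  shows "dominates i l"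
proof (rule ccontr)
  assume "\<not> dominates i l"
  then have li: "dominates l i" using assms(6) unfolding dominates_def by (auto split: if_splits)
  \<comment> \<open>Each coordinate has three slots. \<open>Some True\<close> shifts it in the
    direction that increases the tuple in the ordering, whichever sign the coordinate has,
    \<open>Some False\<close> in the other direction, and \<open>None\<close> leaves it in the
    middle.\<close>
  define pt where "pt = (\<lambda>f a. 3 * a + (if f a = Some (eps a) then 2 else if f a = None then 1 else 0 :: nat))"
  have tp: "tup k m (pt f)" for f
    unfolding tup_def
  proof (intro conjI allI impI)
    fix a b :: nat assume "a < b" "b < k"
    have "pt f a < 3 * a + 3" "3 * b \<le> pt f b" unfolding pt_def by auto
    then show "pt f a < pt f b" using \<open>a < b\<close> by linarith
  next
    fix a assume "a < k"
    moreover have "pt f a < 3 * a + 3" unfolding pt_def by auto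
    ultimately show "pt f a < m" using m by linarith
  qed
  have sep: "pt f a < pt h b" if "a < b" for f h a b
  proof -
    have "pt f a < 3 * a + 3" "3 * b \<le> pt h b" unfolding pt_def by auto
    then show ?thesis using that by linarith
  qed
  \<comment> \<open>Otherwise \<open>P0\<close>, \<open>P1\<close>, \<open>P2\<close> is a cycle: in each step one coordinate beats the one it dominates.\<close>
  define P0 where "P0 = (\<lambda>a::nat. None :: bool option)"
  define P1 where "P1 = (\<lambda>a. if a = i then Some True else if a = j then Some False else None)"
  define P2 where "P2 = (\<lambda>a. if a = i then Some True else if a = l then Some False else None)"
  have "lt (pt P0) (pt P1)"
    by (rule two_step_up[OF tp tp assms(1,2,4)]) (use assms sep in \<open>auto simp: P0_def P1_def pt_def\<close>)
  moreover have "lt (pt P1) (pt P2)"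
    by (rule two_step_up[OF tp tp assms(2,3,5)]) (use assms sep in \<open>auto simp: P2_def P1_def pt_def\<close>)
  moreover have "lt (pt P2) (pt P0)"
    by (rule two_step_up[OF tp tp assms(3,1) assms(6)[symmetric]]) (use assms li sep in \<open>auto simp: P2_def P0_def pt_def\<close>)
  ultimately have "lt (pt P0) (pt P0)" using trans tp by meson
  then show False using irrefl tp by blast
qed

lemma ex_dominating:
  assumes "finite D" "D \<noteq> {}" "D \<subseteq> {..<k}"
  shows "\<exists>i\<in>D. \<forall>j\<in>D. j \<noteq> i \<longrightarrow> dominates i j"
  using assms
proof (induction D rule: finite_ne_induct)
  case (insert x D)
  then obtain i where i: "i \<in> D" "\<forall>j\<in>D. j \<noteq> i \<longrightarrow> dominates i j" by auto
  have xi: "x \<noteq> i" using i insert.hyps by auto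
  show ?case
  proof (cases "dominates i x")
    case True
    then show ?thesis using i by auto
  next
    case False
    then have "dominates x i" using xi unfolding dominates_def by (auto split: if_splits)
    then have "dominates x j" if "j \<in> D" for j
      using dominates_trans[of x i j] i that insert.prems insert.hyps xi by (cases "j = i") auto
    then show ?thesis by auto
  qed
qed simp

text \<open>Every step of the path must move \<open>i\<close>, because only then is its outcome
  known to be \<open>eps i\<close>. With \<open>2 * k\<close> steps, \<open>i\<close> makes unit
  moves first near \<open>p i\<close> and then near \<open>q i\<close>, and the gaps between
  multiples of \<open>2 * k + 1\<close> keep it clear of its neighbours. The long jump between the
  two places happens at the turn of \<open>i\<close> in the raising phase: all higher coordinates
  have been raised by then, and no lower one has.\<close>

lemma path:
  assumes p: "tup k m p" and q: "tup k m q"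
    and dvd: "\<And>a. a < k \<Longrightarrow> 2 * k + 1 dvd p a" "\<And>a. a < k \<Longrightarrow> 2 * k + 1 dvd q a"
    and i: "i < k" "p i < q i" and top: "\<And>j. j < k \<Longrightarrow> j \<noteq> i \<Longrightarrow> p j \<noteq> q j \<Longrightarrow> dominates i j"
  shows "lt p q = eps i"
proof -
  define g where "g = 2 * k + 1"
  have gap: "x + g \<le> y" if "x < y" "g dvd x" "g dvd y" for x y :: nat
  proof -
    have "g dvd y - x" using that by simp
    then have "g \<le> y - x" using that(1) by (intro dvd_imp_le) auto
    then show ?thesis using that(1) by simp
  qed
  define M where "M = (\<lambda>a. max (p a) (q a))"
  \<comment> \<open>The stages of the path from \<open>p\<close> through \<open>M\<close> to \<open>q\<close>: first the coordinates are raised from the last to the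
    first, then they are lowered from the first to the last.\<close>
  define cfg where "cfg = (\<lambda>s a. if a = i then (if s + i < k then p i + s else q i + s - 2 * k)
     else if a + k < s then q a else if k \<le> a + s then M a else p a)"
  have dv: "g dvd p a" "g dvd q a" "g dvd M a" if "a < k" for a
    using dvd[OF that] unfolding g_def M_def max_def by auto
  have pm: "p a < p b" "q a < q b" "M a < M b" "p a < M b" "q a < M b" if "a < b" "b < k" for a b
  proof -
    have "p a < p b" "q a < q b" using p q that unfolding tup_def by auto
    then show "p a < p b" "q a < q b" "M a < M b" "p a < M b" "q a < M b"
      unfolding M_def by (auto simp: max_def)
  qed
  have pg: "p a + g \<le> p b" "q a + g \<le> q b" "M a + g \<le> M b" "p a + g \<le> M b" "q a + g \<le> M b"
    if "a < b" "b < k" for a b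
    using gap pm[OF that] dv that by (meson order.strict_trans)+
  have ig: "p i + g \<le> q i" "M i = q i" using gap i dv unfolding M_def by auto
  have lo: "p a + g \<le> q i" "q a + g \<le> q i" "M a + g \<le> q i" if "a < i" for a
    using pg[OF that i(1)] ig by auto
  have hi: "q i + g \<le> q a" "q i + g \<le> M a" "p i + g \<le> p a" "p i + g \<le> M a" if "i < a" "a < k" for a
    using pg[OF that] by auto
  have x: "s + i < k \<Longrightarrow> cfg s i = p i + s" "k \<le> s + i \<Longrightarrow> cfg s i + 2 * k = q i + s" for s
    using ig unfolding cfg_def g_def by auto
  have less_i: "cfg s a < cfg t i" if "a < i" "s \<le> 2 * k" "t \<le> 2 * k" "s \<le> Suc t" "t \<le> Suc s" for s t a
  proof (cases "t + i < k")
    case True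
    then have "cfg s a = p a" if "s + i \<le> k" "a + s < k"
      using that \<open>a < i\<close> unfolding cfg_def by auto
    moreover have "a + s < k" using True that by simp
    ultimately show ?thesis using x(1)[OF True] pm(1)[OF that(1) i(1)] True that by simp
  next
    case False
    have "cfg s a + g \<le> q i" using lo[OF that(1)] that(1) unfolding cfg_def by simp
    then show ?thesis using x(2)[of t] False unfolding g_def by simp
  qed
  have greater_i: "cfg t i < cfg s a" if "i < a" "a < k" "s \<le> 2 * k" "t \<le> 2 * k" "s \<le> Suc t" "t \<le> Suc s" for s t a
  proof (cases "t + i < k")
    case True
    then have "\<not> a + k < s" using that by simp
    then have "p i + g \<le> cfg s a" using hi[OF that(1,2)] that(1) unfolding cfg_def by simp
    then show ?thesis using x(1)[OF True] True unfolding g_def by simp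
  next
    case False
    then have "k \<le> a + s" using that by simp
    then have "q i + g \<le> cfg s a" using hi[OF that(1,2)] that(1) unfolding cfg_def by simp
    then show ?thesis using x(2)[of t] False that(4) unfolding g_def by simp
  qed
  have tcfg: "tup k m (cfg s)" if s: "s \<le> 2 * k" for s
    unfolding tup_def
  proof (intro conjI allI impI)
    fix a b assume ab: "a < b" "b < k"
    consider "b = i" | "a = i" | "a \<noteq> i" "b \<noteq> i" by blast
    then show "cfg s a < cfg s b"
    proof cases
      case 1
      then show ?thesis using less_i[of a s s] ab s by simp
    next
      case 2
      then show ?thesis using greater_i[of b s s] ab s by simp
    next
      case 3
      then show ?thesis using pm[OF ab] ab unfolding cfg_def by auto
    qed
  next
    fix a assume a: "a < k"
    have "p a < m" "q a < m" "q i < m" using p q a i unfolding tup_def by auto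
    moreover have "cfg s i \<le> q i" using x[of s] ig s unfolding g_def by (cases "s + i < k") auto
    moreover have "cfg s a \<le> max (p a) (q a)" if "a \<noteq> i" using that unfolding cfg_def M_def by auto
    ultimately show "cfg s a < m" by (cases "a = i") auto
  qed
  have inc: "cfg s i < cfg (Suc s) i" if "s < 2 * k" for s
    using ig that unfolding cfg_def g_def by auto
  have step: "lt (cfg s) (cfg (Suc s)) = eps i" if s: "s < 2 * k" for s
  proof -
    have ts: "tup k m (cfg s)" "tup k m (cfg (Suc s))" using tcfg s by simp_all
    \<comment> \<open>The coordinate whose turn it is: counted down from \<open>k - 1\<close> while
      raising, then up from 0 while lowering. At most \<open>c\<close> and \<open>i\<close> change
      in this step.\<close>
    define c where "c = (if s < k then k - 1 - s else s - k)"
    have ck: "c < k" using s i unfolding c_def by auto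
    have eq: "cfg s a = cfg (Suc s) a" if "a < k" "a \<noteq> i" "a \<noteq> c" for a
      using that s unfolding cfg_def c_def by (auto split: if_splits)
    show ?thesis
    proof (cases "c = i \<or> cfg s c = cfg (Suc s) c")
      case True
      then show ?thesis using single[OF ts i(1) inc[OF s]] eq by metis
    next
      case False
      have "p c \<noteq> q c" using False unfolding cfg_def M_def by (auto split: if_splits)
      then have "dominates i c" using top[OF ck] False by simp
      moreover have "cfg (Suc s) i < cfg s c" if "i < c" using greater_i[OF that ck] s by simp
      moreover have "cfg (Suc s) c < cfg s i" if "c < i" using less_i[OF that] s by simp
      ultimately show ?thesis
        using two_step[OF ts i(1) ck _ inc[OF s]] False eq by auto
    qed
  qed
  have chain: "if eps i then lt (cfg 0) (cfg (Suc s)) else lt (cfg (Suc s)) (cfg 0)" if "s < 2 * k" for s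
    using that
  proof (induction s)
    case 0
    then show ?case using step[of 0] neg[OF tcfg[of 0] tcfg[of 1] i(1)] inc[of 0] by auto
  next
    case (Suc s)
    let ?a = "cfg 0" and ?b = "cfg (Suc s)" and ?c = "cfg (Suc (Suc s))"
    have t: "tup k m ?a" "tup k m ?b" "tup k m ?c" using tcfg Suc.prems by simp_all
    show ?case
      using Suc.IH Suc.prems step[of "Suc s"] neg[OF t(2,3) i(1)] inc[of "Suc s"] trans[OF t] trans[OF t(3,2,1)]
      by (auto split: if_splits)
  qed
  have k: "0 < k" using i by simp
  have c0: "cfg 0 a = p a" if "a < k" for a using that i unfolding cfg_def by auto
  have c2: "cfg (2 * k) a = q a" if "a < k" for a using that unfolding cfg_def by auto
  have k2: "Suc (2 * k - 1) = 2 * k" "2 * k - 1 < 2 * k" using k by auto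
  from chain[OF k2(2)] have "if eps i then lt (cfg 0) (cfg (2 * k)) else lt (cfg (2 * k)) (cfg 0)"
    unfolding k2(1) .
  then have "if eps i then lt p q else lt q p"
    using ext[OF c0 c2] ext[OF c2 c0] by (cases "eps i") simp_all
  then show ?thesis using neg[OF p q i(1)] i(2) by (cases "eps i") simp_all
qed

text \<open>Among the coordinates that differ there is one that dominates all the others, and its
  sign and direction of movement decide the comparison. The pattern alone determines which
  coordinate this is and where it moves.\<close>

lemma same_pattern:
  assumes t: "tup k m p" "tup k m q" "tup k m p'" "tup k m q'"
    and dvd: "\<And>a. a < k \<Longrightarrow> 2 * k + 1 dvd p a \<and> 2 * k + 1 dvd q a \<and> 2 * k + 1 dvd p' a \<and> 2 * k + 1 dvd q' a"
    and pat: "\<And>a. a < k \<Longrightarrow> (p a < q a) = (p' a < q' a)" "\<And>a. a < k \<Longrightarrow> (p a = q a) = (p' a = q' a)"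
    and lt: "lt p q"
  shows "lt p' q'"
proof -
  define D where "D = {a. a < k \<and> p a \<noteq> q a}"
  have "D \<noteq> {}"
  proof
    assume "D = {}"
    then have "q a = p a" if "a < k" for a using that unfolding D_def by auto
    then have "lt p p" by (rule ext[OF refl _ lt])
    then show False using irrefl t(1) by blast
  qed
  then obtain i where i: "i \<in> D" "\<forall>j\<in>D. j \<noteq> i \<longrightarrow> dominates i j"
    using ex_dominating[of D] unfolding D_def by auto
  have ik: "i < k" "p i \<noteq> q i" "p' i \<noteq> q' i" using i pat unfolding D_def by auto
  have top: "dominates i j" if "j < k" "j \<noteq> i" "p j \<noteq> q j" for j using i that unfolding D_def by auto
  have top': "dominates i j" if "j < k" "j \<noteq> i" "p' j \<noteq> q' j" for j using top that pat(2)[of j] by simp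
  note dv = conjunct1[OF dvd] conjunct1[OF conjunct2[OF dvd]]
    conjunct1[OF conjunct2[OF conjunct2[OF dvd]]] conjunct2[OF conjunct2[OF conjunct2[OF dvd]]]
  show ?thesis
  proof (cases "p i < q i")
    case True
    then have "p' i < q' i" using pat(1)[OF ik(1)] by simp
    have "lt p q = eps i" by (rule path[OF t(1,2) dv(1,2) ik(1) True]) (auto intro: top)
    moreover have "lt p' q' = eps i" by (rule path[OF t(3,4) dv(3,4) ik(1) \<open>p' i < q' i\<close>]) (auto intro: top')
    ultimately show ?thesis using lt by simp
  next
    case False
    then have less: "q i < p i" "q' i < p' i" using pat(1)[OF ik(1)] ik by auto
    have "lt q p = eps i" by (rule path[OF t(2,1) dv(2,1) ik(1) less(1)]) (auto intro: top)
    moreover have "lt q' p' = eps i" by (rule path[OF t(4,3) dv(4,3) ik(1) less(2)]) (auto intro: top')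
    ultimately show ?thesis using lt neg[OF t(1,2) ik(1,2)] neg[OF t(3,4) ik(1,3)] by simp
  qed
qed

end

section \<open>Colorings induced by an ordering\<close>

definition pos :: "nat set \<Rightarrow> nat \<Rightarrow> nat" where
  "pos Z z = card {u \<in> Z. u < z}"

lemma pos_less:
  assumes "finite Z" "a \<in> Z" "a < b"
  shows "pos Z a < pos Z b"
  unfolding pos_def by (rule psubset_card_mono) (use assms in auto)

lemma pos_inj: "finite Z \<Longrightarrow> a \<in> Z \<Longrightarrow> b \<in> Z \<Longrightarrow> pos Z a = pos Z b \<Longrightarrow> a = b"
  using pos_less by (metis less_irrefl nat_neq_iff)

lemma ex_pos:
  assumes "finite Z" "t < card Z"
  obtains z where "z \<in> Z" "pos Z z = t"
proof -
  have "pos Z z < card Z" if "z \<in> Z" for z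
    unfolding pos_def by (rule psubset_card_mono) (use assms that in auto)
  then have "pos Z ` Z \<subseteq> {..<card Z}" by auto
  moreover have "inj_on (pos Z) Z" using pos_inj[OF assms(1)] by (auto intro: inj_onI)
  then have "card (pos Z ` Z) = card {..<card Z}" by (simp add: card_image)
  ultimately have "pos Z ` Z = {..<card Z}" by (intro card_subset_eq) auto
  then show ?thesis using assms(2) that by (metis imageE lessThan_iff)
qed

lemma pos_image:
  fixes v :: "nat \<Rightarrow> nat"
  assumes mono: "\<And>a b. a < b \<Longrightarrow> b < l \<Longrightarrow> v a < v b" and a: "a < l"
  shows "pos (v ` {..<l}) (v a) = a"
proof -
  have lt: "v b < v a \<longleftrightarrow> b < a" if "b < l" for b
    using mono[of a b] mono[of b a] a that by (metis less_asym less_irrefl nat_neq_iff)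
  have "{u \<in> v ` {..<l}. u < v a} = v ` {..<a}" using lt a by (auto simp: image_iff)
  moreover have "inj_on v {..<a}" using mono a by (intro inj_onI) (metis less_irrefl less_trans lessThan_iff nat_neq_iff)
  ultimately show ?thesis unfolding pos_def by (simp add: card_image)
qed

text \<open>
  The color of \<open>Z = {z\<^sub>0 < \<dots> < z\<^sub>k}\<close> consists of those \<open>i\<close> for which moving the \<open>i\<close>-th coordinate from \<open>z\<^sub>i\<close> up to
  \<open>z\<^bsub>i+1\<^esub>\<close> increases the set. The predicate \<open>quad r (i, j, b)\<close> compares the two sets in which the coordinates \<open>i < j\<close> are moved
  in opposite directions (if \<open>b\<close>) or in the same direction (if \<open>\<not> b\<close>).
\<close>

definition color :: "nat \<Rightarrow> nat set rel \<Rightarrow> nat set \<Rightarrow> nat set" where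
  "color k r Z = {i. i < k \<and> (\<exists>y\<in>Z. \<exists>y'\<in>Z. pos Z y = i \<and> pos Z y' = Suc i \<and> (Z - {y'}, Z - {y}) \<in> r)}"

definition quad :: "nat set rel \<Rightarrow> nat \<times> nat \<times> bool \<Rightarrow> nat set \<Rightarrow> bool" where
  "quad r = (\<lambda>(i, j, b) U. \<exists>x\<in>U. \<exists>y\<in>U. \<exists>z\<in>U. \<exists>w\<in>U.
     pos U x = i \<and> pos U y = Suc i \<and> pos U z = Suc j \<and> pos U w = Suc (Suc j) \<and>
     (if b then (U - {y, z}, U - {x, w}) \<in> r else (U - {y, w}, U - {x, z}) \<in> r))"

lemma color_iff:
  assumes "finite Z" "y \<in> Z" "y' \<in> Z" "pos Z y = i" "pos Z y' = Suc i" "i < k"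
  shows "i \<in> color k r Z \<longleftrightarrow> (Z - {y'}, Z - {y}) \<in> r"
proof
  assume "i \<in> color k r Z"
  then obtain u u' where "u \<in> Z" "u' \<in> Z" "pos Z u = i" "pos Z u' = Suc i" "(Z - {u'}, Z - {u}) \<in> r"
    unfolding color_def by blast
  then show "(Z - {y'}, Z - {y}) \<in> r"
    using pos_inj[OF assms(1)] assms(2-5) by metis
qed (use assms in \<open>auto simp: color_def\<close>)

lemma quad_iff:
  assumes "finite U" "x \<in> U" "y \<in> U" "z \<in> U" "w \<in> U"
    and "pos U x = i" "pos U y = Suc i" "pos U z = Suc j" "pos U w = Suc (Suc j)"
  shows "quad r (i, j, b) U \<longleftrightarrow>
     (if b then (U - {y, z}, U - {x, w}) \<in> r else (U - {y, w}, U - {x, z}) \<in> r)" (is "_ \<longleftrightarrow> ?R x y z w")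
proof
  assume "quad r (i, j, b) U"
  then obtain x' y' z' w' where *: "x' \<in> U" "y' \<in> U" "z' \<in> U" "w' \<in> U" "pos U x' = i" "pos U y' = Suc i"
     "pos U z' = Suc j" "pos U w' = Suc (Suc j)" "?R x' y' z' w'"
    unfolding quad_def case_prod_conv by blast
  have eqs: "x' = x" "y' = y" "z' = z" "w' = w"
    using pos_inj[OF assms(1)] * assms(2-) by metis+
  show "?R x y z w" using *(9) unfolding eqs .
next
  assume "?R x y z w"
  then show "quad r (i, j, b) U" unfolding quad_def case_prod_conv using assms by blast
qed

text \<open>Only one of the two sets compared by \<open>quad\<close> contains the argument
  \<open>y\<close> at position \<open>i + 1\<close>. Replacing \<open>y\<close> by \<open>y'\<close>
  changes this set in its \<open>i\<close>-th coordinate alone, so transitivity makes the predicate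
  monotone, in the direction given by membership of \<open>i\<close> in the color. The tail
  \<open>E\<close> consists of the remaining \<open>k - i\<close> points, one of which is absent
  from that set and hence from the color.\<close>

lemma deferred_monotone_quad:
  assumes lin: "strict_linear_order_on (nsets {..<N} k) r" and ij: "i < j" "j < k"
  shows "deferred_monotone (k - i) N (Suc k) (color k r) (quad r (i, j, b))"
proof -
  have tr: "trans r" and irr: "irrefl r" and tot: "total_on (nsets {..<N} k) r"
    using lin unfolding strict_linear_order_on_def by auto
  have "\<exists>dir. \<forall>D x y y' E. D \<subseteq> {..<x} \<longrightarrow> x < y \<longrightarrow> y < y' \<longrightarrow> E \<subseteq> {y'<..<N} \<longrightarrow>
        card E = k - i \<longrightarrow> Suc (card D + card E) = Suc k \<longrightarrow>
        (\<exists>e\<in>E. quad r (i, j, b) (insert x (insert y (D \<union> E))) = dir (color k r (insert y (insert y' (D \<union> (E - {e}))))) \<longrightarrow>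
               quad r (i, j, b) (insert x (insert y' (D \<union> E))) = dir (color k r (insert y (insert y' (D \<union> (E - {e}))))))"
  proof (intro exI[of _ "\<lambda>C. i \<in> C"] allI impI)
    fix D x y y' E
    assume D: "D \<subseteq> {..<x}" "x < y" "y < y'" "E \<subseteq> {y'<..<N}" "card E = k - i" "Suc (card D + card E) = Suc k"
    have fin: "finite D" "finite E" using D(1,4) by (auto intro: finite_subset)
    have cD: "card D = i" using D(5,6) ij by simp
    have cE: "0 < card E" "j - i < card E" "j - i - 1 < card E" using D(5) ij by auto
    obtain z where z: "z \<in> E" "pos E z = j - i - 1" using ex_pos[OF fin(2) cE(3)] by blast
    obtain w where w: "w \<in> E" "pos E w = j - i" using ex_pos[OF fin(2) cE(2)] by blast
    have zw: "z \<noteq> w" using z w ij by auto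
    have D_lt: "d < x" if "d \<in> D" for d using D(1) that by auto
    have E_gt: "y' < e" "e < N" if "e \<in> E" for e using D(4) that by auto
    have U: "pos (insert x (insert u (D \<union> E))) x = i \<and> pos (insert x (insert u (D \<union> E))) u = Suc i \<and>
       pos (insert x (insert u (D \<union> E))) z = Suc j \<and> pos (insert x (insert u (D \<union> E))) w = Suc (Suc j)"
      if u: "x < u" "u \<le> y'" for u
    proof -
      let ?U = "insert x (insert u (D \<union> E))"
      have "{v \<in> ?U. v < x} = D" "{v \<in> ?U. v < u} = insert x D"
        using D_lt E_gt u by (force dest: D_lt E_gt)+
      moreover have "{v \<in> ?U. v < e} = insert x (insert u (D \<union> {v \<in> E. v < e}))" if "e \<in> E" for e
        using D_lt E_gt(1)[OF that] u by (force dest: D_lt)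
      moreover have "card (insert x (insert u (D \<union> {v \<in> E. v < e}))) = Suc (Suc (i + pos E e))" for e
      proof -
        have "card (D \<union> {v \<in> E. v < e}) = i + pos E e"
          unfolding pos_def cD[symmetric] using fin D_lt E_gt u D(2,3) by (intro card_Un_disjoint) force+
        moreover have "x \<notin> insert u (D \<union> {v \<in> E. v < e})" "u \<notin> D \<union> {v \<in> E. v < e}"
          using u D_lt E_gt D(2,3) by force+
        ultimately show ?thesis using fin by simp
      qed
      moreover have "card (insert x D) = Suc i" using cD fin D_lt by (subst card_insert_disjoint) auto
      ultimately show ?thesis
        using z w cD ij unfolding pos_def[of ?U] by simp
    qed
    have Uy: "quad r (i, j, b) (insert x (insert u (D \<union> E))) \<longleftrightarrow>
        (if b then (insert x (insert u (D \<union> E)) - {u, z}, insert x (insert u (D \<union> E)) - {x, w}) \<in> r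
         else (insert x (insert u (D \<union> E)) - {u, w}, insert x (insert u (D \<union> E)) - {x, z}) \<in> r)"
      if "x < u" "u \<le> y'" for u
      by (rule quad_iff) (use U[OF that] fin z w in auto)
    \<comment> \<open>\<open>e\<close> is the tail point missing from the set that contains
      \<open>u\<close>, and \<open>f\<close> the one missing from the set that contains
      \<open>x\<close>.\<close>
    define e where "e = (if b then w else z)"
    define f where "f = (if b then z else w)"
    have ef: "e \<in> E" "f \<in> E" using z w unfolding e_def f_def by auto
    let ?Q = "\<lambda>u. insert u (D \<union> (E - {e}))" and ?P = "insert x (D \<union> (E - {f}))"
    have quad: "quad r (i, j, b) (insert x (insert u (D \<union> E))) \<longleftrightarrow> (?P, ?Q u) \<in> r" if "x < u" "u \<le> y'" for u
    proof -
      have nu: "u \<notin> D" "u \<notin> E" "x \<notin> D" "x \<notin> E" "x \<noteq> u" using D_lt E_gt that D(2,3) by force+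
      have nf: "f \<noteq> x" "f \<noteq> u" "f \<notin> D" "e \<noteq> x" "e \<noteq> u" "e \<notin> D"
        using D_lt[of f] D_lt[of e] E_gt[OF ef(1)] E_gt[OF ef(2)] that D(2,3) by auto
      have "insert x (insert u (D \<union> E)) - {u, f} = ?P" "insert x (insert u (D \<union> E)) - {x, e} = ?Q u"
        using nu nf by auto
      then show ?thesis unfolding Uy[OF that] e_def f_def by (auto split: if_splits)
    qed
    let ?Z = "insert y (insert y' (D \<union> (E - {e})))"
    have ny: "y \<notin> D" "y \<notin> E" "y' \<notin> D" "y' \<notin> E" "y \<noteq> y'" using D_lt E_gt D(2,3) by force+
    have "{v \<in> ?Z. v < y} = D" "{v \<in> ?Z. v < y'} = insert y D"
      using D_lt E_gt D(2,3) by (force dest: D_lt E_gt)+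
    then have "pos ?Z y = i" "pos ?Z y' = Suc i" unfolding pos_def using cD fin ny by simp_all
    then have "i \<in> color k r ?Z \<longleftrightarrow> (?Z - {y'}, ?Z - {y}) \<in> r"
      using fin ij by (intro color_iff) auto
    moreover have "?Z - {y'} = ?Q y" "?Z - {y} = ?Q y'" using ny by auto
    ultimately have col: "i \<in> color k r ?Z \<longleftrightarrow> (?Q y, ?Q y') \<in> r" by simp
    have ns: "?Q u \<in> nsets {..<N} k" if "u = y \<or> u = y'" for u
    proof -
      have "u \<notin> D \<union> (E - {e})" using ny that by auto
      moreover have "card (D \<union> (E - {e})) = i + (card E - 1)"
        unfolding cD[symmetric] using fin ef(1) D_lt E_gt D(2,3)
        by (subst card_Un_disjoint) (force simp: card_Diff_singleton)+
      ultimately have "card (?Q u) = k" using fin D(5) ij by simp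
      moreover have "y' < N" using E_gt[OF ef(1)] by simp
      then have "?Q u \<subseteq> {..<N}" using that D_lt E_gt D(2,3) by force
      ultimately show ?thesis using fin by (simp add: nsets_def)
    qed
    have ne: "?Q y \<noteq> ?Q y'" using ny by auto
    show "\<exists>e\<in>E. quad r (i, j, b) (insert x (insert y (D \<union> E))) = (i \<in> color k r (insert y (insert y' (D \<union> (E - {e}))))) \<longrightarrow>
               quad r (i, j, b) (insert x (insert y' (D \<union> E))) = (i \<in> color k r (insert y (insert y' (D \<union> (E - {e})))))"
    proof (rule bexI[of _ e])
      have q1: "quad r (i, j, b) (insert x (insert y (D \<union> E))) \<longleftrightarrow> (?P, ?Q y) \<in> r"
        and q2: "quad r (i, j, b) (insert x (insert y' (D \<union> E))) \<longleftrightarrow> (?P, ?Q y') \<in> r"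
        using quad D(2,3) by auto
      show "quad r (i, j, b) (insert x (insert y (D \<union> E))) = (i \<in> color k r ?Z) \<longrightarrow>
               quad r (i, j, b) (insert x (insert y' (D \<union> E))) = (i \<in> color k r ?Z)"
      proof (cases "(?Q y, ?Q y') \<in> r")
        case True
        have "(?P, ?Q y) \<in> r \<longrightarrow> (?P, ?Q y') \<in> r" by (rule impI) (rule transD[OF tr _ True])
        then show ?thesis unfolding q1 q2 col using True by simp
      next
        case False
        have "(?Q y', ?Q y) \<in> r"
          using tot[unfolded total_on_def, THEN bspec, THEN bspec, OF ns ns, of y y'] ne False by simp
        then have "(?P, ?Q y') \<in> r \<longrightarrow> (?P, ?Q y) \<in> r" by (intro impI) (rule transD[OF tr])
        then show ?thesis unfolding q1 q2 col using False by (cases "(?P, ?Q y) \<in> r") simp_all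
      qed
    qed (rule ef(1))
  qed
  moreover have "k - i \<noteq> 0" using ij by simp
  ultimately show ?thesis unfolding deferred_monotone_def by (simp only: if_False)
qed

section \<open>Increasing tuples read as subsets of a homogeneous set\<close>

lemma increasing_image:
  fixes e v :: "nat \<Rightarrow> nat"
  assumes e: "\<And>a b. a < b \<Longrightarrow> b < m \<Longrightarrow> e a < e b"
    and v: "\<And>a b. a < b \<Longrightarrow> b < l \<Longrightarrow> v a < v b" "\<And>a. a < l \<Longrightarrow> v a < m"
  shows "(\<lambda>a. e (v a)) ` {..<l} \<in> nsets (e ` {..<m}) l"
    and "inj_on (\<lambda>a. e (v a)) {..<l}"
    and "a < l \<Longrightarrow> pos ((\<lambda>a. e (v a)) ` {..<l}) (e (v a)) = a"
proof -
  have mono: "e (v a) < e (v b)" if "a < b" "b < l" for a b using e v that by simp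
  show inj: "inj_on (\<lambda>a. e (v a)) {..<l}"
  proof (rule inj_onI)
    fix a b assume "a \<in> {..<l}" "b \<in> {..<l}" "e (v a) = e (v b)"
    then show "a = b" using mono[of a b] mono[of b a] by (cases a b rule: linorder_cases) auto
  qed
  show "(\<lambda>a. e (v a)) ` {..<l} \<in> nsets (e ` {..<m}) l"
    using card_image[OF inj] v(2) by (auto simp: nsets_def)
  show "a < l \<Longrightarrow> pos ((\<lambda>a. e (v a)) ` {..<l}) (e (v a)) = a"
    by (rule pos_image) (use mono in auto)
qed

lemma image_remove_one:
  assumes "inj_on v {..<Suc l}" "c \<le> l" and w: "\<And>a. a < l \<Longrightarrow> w a = v (if a < c then a else Suc a)"
  shows "v ` {..<Suc l} - {v c} = w ` {..<l}"
proof -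
  have "{..<Suc l} - {c} = (\<lambda>a. if a < c then a else Suc a) ` {..<l}" (is "_ = ?f ` _")
  proof (intro equalityI subsetI)
    fix b assume "b \<in> {..<Suc l} - {c}"
    then have "b = ?f (if b < c then b else b - 1)" "(if b < c then b else b - 1) \<in> {..<l}"
      using assms(2) by auto
    then show "b \<in> ?f ` {..<l}" by blast
  qed (use assms(2) in auto)
  then have "v ` ({..<Suc l} - {c}) = w ` {..<l}" using w by (auto simp: image_image)
  moreover have "v ` ({..<Suc l} - {c}) = v ` {..<Suc l} - v ` {c}"
    by (rule inj_on_image_set_diff[OF assms(1)]) (use assms(2) in auto)
  ultimately show ?thesis by simp
qed

lemma image_remove_two:
  assumes inj: "inj_on v {..<Suc (Suc l)}" and cd: "c < d" "d < Suc (Suc l)"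
    and w: "\<And>a. a < l \<Longrightarrow> w a = v (if a < c then a else if Suc a < d then Suc a else Suc (Suc a))"
  shows "v ` {..<Suc (Suc l)} - {v c, v d} = w ` {..<l}"
proof -
  have "{..<Suc (Suc l)} - {c, d} = (\<lambda>a. if a < c then a else if Suc a < d then Suc a else Suc (Suc a)) ` {..<l}" (is "_ = ?f ` _")
  proof (intro equalityI subsetI)
    fix b assume b: "b \<in> {..<Suc (Suc l)} - {c, d}"
    define a where "a = (if b < c then b else if b < d then b - 1 else b - 2)"
    have "b = ?f a" "a \<in> {..<l}" using b cd unfolding a_def by auto
    then show "b \<in> ?f ` {..<l}" by blast
  qed (use cd in auto)
  then have "v ` ({..<Suc (Suc l)} - {c, d}) = w ` {..<l}" using w by (auto simp: image_image)
  moreover have "v ` ({..<Suc (Suc l)} - {c, d}) = v ` {..<Suc (Suc l)} - v ` {c, d}"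
    by (rule inj_on_image_set_diff[OF inj]) (use cd in auto)
  ultimately show ?thesis by simp
qed

text \<open>Two tuples that differ in one or two coordinates are merged into one increasing sequence
  \<open>v\<close>; each is recovered by deleting the points that belong only to the other, which is
  the form in which \<open>color\<close> and \<open>quad\<close> compare sets. By homogeneity the
  existential quantifiers in the conclusion may be tested on this merged set.\<close>

lemma coord_order_homogeneous:
  fixes e :: "nat \<Rightarrow> nat"
  defines "S \<equiv> \<lambda>m. e ` {..<m}" and "st \<equiv> \<lambda>k p. (\<lambda>a. e (p a)) ` {..<k::nat}"
  assumes lin: "strict_linear_order_on (nsets {..<N} k) r"
    and e: "\<And>a b. a < b \<Longrightarrow> b < m \<Longrightarrow> e a < e b" and eN: "S m \<subseteq> {..<N}" and m: "3 * k \<le> m"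
    and hcol: "\<And>V V'. V \<in> nsets (S m) (Suc k) \<Longrightarrow> V' \<in> nsets (S m) (Suc k) \<Longrightarrow> color k r V = color k r V'"
    and hq: "\<And>i j b V V'. i < j \<Longrightarrow> j < k \<Longrightarrow> V \<in> nsets (S m) (Suc (Suc k)) \<Longrightarrow> V' \<in> nsets (S m) (Suc (Suc k)) \<Longrightarrow>
        quad r (i, j, b) V = quad r (i, j, b) V'"
  shows "coord_order k m (\<lambda>p q. (st k p, st k q) \<in> r) (\<lambda>i. \<exists>Z\<in>nsets (S m) (Suc k). i \<in> color k r Z)
    (\<lambda>i j. \<exists>U\<in>nsets (S m) (Suc (Suc k)). quad r (i, j, True) U)
    (\<lambda>i j. \<exists>U\<in>nsets (S m) (Suc (Suc k)). quad r (i, j, False) U)"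
proof
  have tr: "trans r" and irr: "irrefl r" and tot: "total_on (nsets {..<N} k) r"
    using lin unfolding strict_linear_order_on_def by auto
  have T: "p a < p b" if "tup k m p" "a < b" "b < k" for p a b using that unfolding tup_def by blast
  have Tm: "p a < m" if "tup k m p" "a < k" for p a using that unfolding tup_def by blast
  note im = increasing_image[of m e, OF e]
  show "3 * k \<le> m" by (rule m)
  fix p q assume p: "tup k m p" and q: "tup k m q"
  show "(st k p, st k q) \<in> r \<or> (st k q, st k p) \<in> r" if a: "a < k" "p a \<noteq> q a" for a
  proof -
    have "e (p a) \<noteq> e (q a)"
      using e[of "p a" "q a"] e[of "q a" "p a"] Tm[OF p a(1)] Tm[OF q a(1)] a(2)
      by (cases "p a" "q a" rule: linorder_cases) auto
    moreover have "e (p a) = e (q a)" if eq: "st k p = st k q"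
    proof (rule pos_inj)
      show "finite (st k p)" "e (p a) \<in> st k p" using a unfolding st_def by auto
      show "e (q a) \<in> st k p" using a unfolding eq by (auto simp: st_def)
      have "pos (st k p) (e (p a)) = a"
        unfolding st_def by (rule im(3)) (use T[OF p] Tm[OF p] a in auto)
      moreover have "pos (st k q) (e (q a)) = a"
        unfolding st_def by (rule im(3)) (use T[OF q] Tm[OF q] a in auto)
      ultimately show "pos (st k p) (e (p a)) = pos (st k p) (e (q a))" using eq by simp
    qed
    ultimately have ne: "st k p \<noteq> st k q" by blast
    have "st k s \<in> nsets {..<N} k" if "tup k m s" for s
    proof -
      have "st k s \<in> nsets (S m) k"
        unfolding st_def S_def by (rule im(1)) (use T[OF that] Tm[OF that] in auto)
      then show ?thesis using eN by (auto simp: nsets_def)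
    qed
    then show ?thesis using tot[unfolded total_on_def, THEN bspec, THEN bspec, THEN mp, OF _ _ ne] p q ne by simp
  qed
  show "((st k p, st k q) \<in> r) = (\<exists>Z\<in>nsets (S m) (Suc k). i \<in> color k r Z)"
    if i: "i < k" "p i < q i" and eq: "\<And>a. a < k \<Longrightarrow> a \<noteq> i \<Longrightarrow> p a = q a" for i
  proof -
    define v where "v = (\<lambda>a. if a \<le> i then p a else q (a - 1))"
    have v1: "v a < v b" if ab: "a < b" "b < Suc k" for a b
    proof -
      consider "b \<le> i" | "a < i" "i < b" | "a = i" "b = Suc i" | "a = i" "Suc i < b" | "i < a"
        using ab by linarith
      then show ?thesis
      proof cases
        case 1
        then show ?thesis using T[OF p, of a b] ab i unfolding v_def by simp
      next
        case 2
        then show ?thesis using T[OF q, of a "b - 1"] eq[of a] ab i unfolding v_def by simp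
      next
        case 3
        then show ?thesis using i unfolding v_def by simp
      next
        case 4
        then have "q i < q (b - 1)" using T[OF q, of i "b - 1"] ab by linarith
        then show ?thesis using 4 i unfolding v_def by simp
      next
        case 5
        then show ?thesis using T[OF q, of "a - 1" "b - 1"] ab unfolding v_def by simp
      qed
    qed
    have v2: "v a < m" if "a < Suc k" for a
      using that Tm[OF p, of a] Tm[OF q, of "a - 1"] i unfolding v_def by auto
    define V where "V = (\<lambda>a. e (v a)) ` {..<Suc k}"
    have V: "V \<in> nsets (S m) (Suc k)" unfolding V_def S_def by (rule im(1)) (simp_all add: v1 v2)
    have inj: "inj_on (\<lambda>a. e (v a)) {..<Suc k}" by (rule im(2)) (simp_all add: v1 v2)
    have posV: "pos V (e (v a)) = a" if "a < Suc k" for a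
      unfolding V_def by (rule im(3)) (simp_all add: v1 v2 that)
    have "i \<in> color k r V \<longleftrightarrow> (V - {e (v (Suc i))}, V - {e (v i)}) \<in> r"
      by (rule color_iff) (use i posV in \<open>auto simp: V_def\<close>)
    moreover have "V - {e (v (Suc i))} = st k p"
      unfolding V_def st_def
      by (rule image_remove_one[OF inj]) (use i eq in \<open>auto simp: v_def less_Suc_eq_le\<close>)
    moreover have "V - {e (v i)} = st k q"
      unfolding V_def st_def
      by (rule image_remove_one[OF inj]) (use i eq in \<open>auto simp: v_def\<close>)
    ultimately have "i \<in> color k r V \<longleftrightarrow> (st k p, st k q) \<in> r" by simp
    then show ?thesis using V hcol by blast
  qed
  show "((st k p, st k q) \<in> r) = (\<exists>U\<in>nsets (S m) (Suc (Suc k)). quad r (i, j, True) U)"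
    if ij: "i < j" "j < k" and lt: "p i < q i" "q i < q j" "q j < p j"
      and eq: "\<And>a. a < k \<Longrightarrow> a \<noteq> i \<Longrightarrow> a \<noteq> j \<Longrightarrow> p a = q a" for i j
  proof -
    \<comment> \<open>The merged order is \<open>p i\<close>, \<open>q i\<close>, the common
      coordinates in between, \<open>q j\<close>, \<open>p j\<close>, so indices are shifted by one
      between the two moved coordinates and by two from \<open>p j\<close> on.\<close>
    define v where "v = (\<lambda>a. if a \<le> i then p a else if a \<le> Suc j then q (a - 1) else p (a - 2))"
    have v1: "v a < v b" if ab: "a < b" "b < Suc (Suc k)" for a b
    proof -
      have vs: "v a < v (Suc a)" if a: "Suc a < Suc (Suc k)" for a
      proof -
        consider "Suc a \<le> i" | "a = i" | "i < a" "a \<le> j" | "a = Suc j" | "Suc j < a" by linarith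
        then show ?thesis
        proof cases
          case 1
          then show ?thesis using T[OF p, of a "Suc a"] ij unfolding v_def by simp
        next
          case 2
          then show ?thesis using lt ij unfolding v_def by simp
        next
          case 3
          then show ?thesis using T[OF q, of "a - 1" a] ij unfolding v_def by simp
        next
          case 4
          then show ?thesis using lt ij unfolding v_def by simp
        next
          case 5
          then show ?thesis using T[OF p, of "a - 2" "a - 1"] a ij unfolding v_def by (simp add: numeral_2_eq_2)
        qed
      qed
      show ?thesis using ab
      proof (induction b)
        case (Suc b)
        then show ?case using vs[of b] by (cases "a = b") auto
      qed simp
    qed
    have v2: "v a < m" if "a < Suc (Suc k)" for a
      using that Tm[OF p, of a] Tm[OF q, of "a - 1"] Tm[OF p, of "a - 2"] ij unfolding v_def by auto
    define V where "V = (\<lambda>a. e (v a)) ` {..<Suc (Suc k)}"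
    have V: "V \<in> nsets (S m) (Suc (Suc k))" unfolding V_def S_def by (rule im(1)) (simp_all add: v1 v2)
    have inj: "inj_on (\<lambda>a. e (v a)) {..<Suc (Suc k)}" by (rule im(2)) (simp_all add: v1 v2)
    have posV: "pos V (e (v a)) = a" if "a < Suc (Suc k)" for a
      unfolding V_def by (rule im(3)) (simp_all add: v1 v2 that)
    have "quad r (i, j, True) V \<longleftrightarrow>
      (if True then (V - {e (v (Suc i)), e (v (Suc j))}, V - {e (v i), e (v (Suc (Suc j)))}) \<in> r
       else (V - {e (v (Suc i)), e (v (Suc (Suc j)))}, V - {e (v i), e (v (Suc j))}) \<in> r)"
      by (rule quad_iff) (use ij posV in \<open>auto simp: V_def\<close>)
    moreover have "V - {e (v (Suc i)), e (v (Suc j))} = st k p"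
      unfolding V_def st_def
      by (rule image_remove_two[OF inj]) (use ij eq in \<open>auto simp: v_def\<close>)
    moreover have "V - {e (v i), e (v (Suc (Suc j)))} = st k q"
      unfolding V_def st_def
      by (rule image_remove_two[OF inj]) (use ij eq in \<open>auto simp: v_def\<close>)
    ultimately have "quad r (i, j, True) V \<longleftrightarrow> (st k p, st k q) \<in> r" by simp
    then show ?thesis using V hq[OF ij] by blast
  qed
  show "((st k p, st k q) \<in> r) = (\<exists>U\<in>nsets (S m) (Suc (Suc k)). quad r (i, j, False) U)"
    if ij: "i < j" "j < k" and lt: "p i < q i" "q i < p j" "p j < q j"
      and eq: "\<And>a. a < k \<Longrightarrow> a \<noteq> i \<Longrightarrow> a \<noteq> j \<Longrightarrow> p a = q a" for i j
  proof -
    \<comment> \<open>Now \<open>p j\<close> precedes \<open>q j\<close>, and \<open>q i\<close>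
      gets a clause of its own: for \<open>j = Suc i\<close> it is followed directly by
      \<open>p j\<close>.\<close>
    define v where "v = (\<lambda>a. if a \<le> i then p a else if a = Suc i then q i else if a \<le> Suc j then p (a - 1) else q (a - 2))"
    have v1: "v a < v b" if ab: "a < b" "b < Suc (Suc k)" for a b
    proof -
      have vs: "v a < v (Suc a)" if a: "Suc a < Suc (Suc k)" for a
      proof -
        consider "Suc a \<le> i" | "a = i" | "a = Suc i" "a < j" | "a = Suc i" "a = j" | "Suc i < a" "a \<le> j" | "a = Suc j" | "Suc j < a"
          using ij by linarith
        then show ?thesis
        proof cases
          case 1
          then show ?thesis using T[OF p, of a "Suc a"] ij unfolding v_def by simp
        next
          case 2
          then show ?thesis using lt ij unfolding v_def by simp
        next
          case 3
          then show ?thesis using T[OF q, of i "Suc i"] eq[of "Suc i"] ij unfolding v_def by simp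
        next
          case 4
          then show ?thesis using lt ij unfolding v_def by simp
        next
          case 5
          then show ?thesis using T[OF p, of "a - 1" a] ij unfolding v_def by simp
        next
          case 6
          then show ?thesis using lt ij unfolding v_def by simp
        next
          case 7
          then show ?thesis using T[OF q, of "a - 2" "a - 1"] a ij unfolding v_def by (simp add: numeral_2_eq_2)
        qed
      qed
      show ?thesis using ab
      proof (induction b)
        case (Suc b)
        then show ?case using vs[of b] by (cases "a = b") auto
      qed simp
    qed
    have v2: "v a < m" if "a < Suc (Suc k)" for a
      using that Tm[OF p, of a] Tm[OF p, of "a - 1"] Tm[OF q, of i] Tm[OF q, of "a - 2"] ij unfolding v_def by auto
    define V where "V = (\<lambda>a. e (v a)) ` {..<Suc (Suc k)}"
    have V: "V \<in> nsets (S m) (Suc (Suc k))" unfolding V_def S_def by (rule im(1)) (simp_all add: v1 v2)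
    have inj: "inj_on (\<lambda>a. e (v a)) {..<Suc (Suc k)}" by (rule im(2)) (simp_all add: v1 v2)
    have posV: "pos V (e (v a)) = a" if "a < Suc (Suc k)" for a
      unfolding V_def by (rule im(3)) (simp_all add: v1 v2 that)
    have "quad r (i, j, False) V \<longleftrightarrow>
      (if False then (V - {e (v (Suc i)), e (v (Suc j))}, V - {e (v i), e (v (Suc (Suc j)))}) \<in> r
       else (V - {e (v (Suc i)), e (v (Suc (Suc j)))}, V - {e (v i), e (v (Suc j))}) \<in> r)"
      by (rule quad_iff) (use ij posV in \<open>auto simp: V_def\<close>)
    moreover have "V - {e (v (Suc i)), e (v (Suc (Suc j)))} = st k p"
      unfolding V_def st_def
      by (rule image_remove_two[OF inj]) (use ij eq in \<open>auto simp: v_def\<close>)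
    moreover have "V - {e (v i), e (v (Suc j))} = st k q"
      unfolding V_def st_def
      by (rule image_remove_two[OF inj]) (use ij eq in \<open>auto simp: v_def\<close>)
    ultimately have "quad r (i, j, False) V \<longleftrightarrow> (st k p, st k q) \<in> r" by simp
    then show ?thesis using V hq[OF ij] by blast
  qed
  show "\<not> (st k p, st k p) \<in> r" using irr unfolding irrefl_def by blast
  show "(st k p, st k s) \<in> r" if "(st k p, st k q) \<in> r" "(st k q, st k s) \<in> r" for s
    using transD[OF tr that] .
next
  fix p p' q q' :: "nat \<Rightarrow> nat"
  assume "\<And>a. a < k \<Longrightarrow> p a = p' a" "\<And>a. a < k \<Longrightarrow> q a = q' a" "(st k p, st k q) \<in> r"
  moreover from this have "st k p = st k p'" "st k q = st k q'" unfolding st_def by (auto intro!: image_cong)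
  ultimately show "(st k p', st k q') \<in> r" by simp
qed

section \<open>Canonical subsets\<close>

text \<open>An increasing map sends the sorted enumeration of a set to that of its image. It
  therefore preserves, coordinate by coordinate, how two \<open>k\<close>-sets compare, and
  invariance under equal patterns is enough.\<close>

lemma canonicalI:
  fixes f :: "nat \<Rightarrow> nat"
  assumes f: "\<And>a b. a < b \<Longrightarrow> b < n \<Longrightarrow> f a < f b"
    and inv: "\<And>t s t' s'. tup k n t \<Longrightarrow> tup k n s \<Longrightarrow> tup k n t' \<Longrightarrow> tup k n s' \<Longrightarrow>
      (\<And>a. a < k \<Longrightarrow> (t a < s a) = (t' a < s' a)) \<Longrightarrow> (\<And>a. a < k \<Longrightarrow> (t a = s a) = (t' a = s' a)) \<Longrightarrow>
      ((\<lambda>a. f (t a)) ` {..<k}, (\<lambda>a. f (s a)) ` {..<k}) \<in> r \<Longrightarrow>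
      ((\<lambda>a. f (t' a)) ` {..<k}, (\<lambda>a. f (s' a)) ` {..<k}) \<in> r"
  shows "canonical k (f ` {..<n}) r"
  unfolding canonical_def
proof (intro allI impI)
  fix A B g
  assume A: "A \<subseteq> f ` {..<n}" and B: "B \<subseteq> f ` {..<n}" and g: "bij_betw g A B" "strict_mono_on A g"
  have f_less: "x < y \<longleftrightarrow> f x < f y" if "x < n" "y < n" for x y
    using f[of x y] f[of y x] that by (cases x y rule: linorder_cases) auto
  have f_eq: "x = y \<longleftrightarrow> f x = f y" if "x < n" "y < n" for x y
    using f_less[of x y] f_less[of y x] that by auto
  have enum: "\<exists>t t'. tup k n t \<and> tup k n t' \<and> (\<forall>a<k. f (t a) \<in> A \<and> f (t' a) = g (f (t a))) \<and>
      P = (\<lambda>a. f (t a)) ` {..<k} \<and> g ` P = (\<lambda>a. f (t' a)) ` {..<k}"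
    if P: "P \<in> nsets A k" for P
  proof -
    have P': "P \<subseteq> A" "finite P" "card P = k" using P by (auto simp: nsets_def)
    from ex_bij_betw_strict_mono_card[OF P'(2)] obtain h where h: "bij_betw h {..<k} P" "strict_mono_on {..<k} h"
      unfolding P'(3) by blast
    have hA: "h a \<in> A" if "a < k" for a using h(1) that P'(1) unfolding bij_betw_def by auto
    have gB: "g x \<in> f ` {..<n}" if "x \<in> A" for x using g(1) B that unfolding bij_betw_def by auto
    have "\<forall>a. \<exists>x. a < k \<longrightarrow> x < n \<and> f x = h a" using hA A by (metis imageE lessThan_iff subsetD)
    then obtain t where t: "\<And>a. a < k \<Longrightarrow> t a < n \<and> f (t a) = h a" by metis
    have "\<forall>a. \<exists>x. a < k \<longrightarrow> x < n \<and> f x = g (h a)" using gB[OF hA] by (metis imageE lessThan_iff)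
    then obtain t' where t': "\<And>a. a < k \<Longrightarrow> t' a < n \<and> f (t' a) = g (h a)" by metis
    have hm: "h a < h b" "g (h a) < g (h b)" if "a < b" "b < k" for a b
    proof -
      show hab: "h a < h b" using strict_mono_onD[OF h(2), of a b] that by simp
      show "g (h a) < g (h b)" using strict_mono_onD[OF g(2) _ _ hab] hA that by simp
    qed
    have "tup k n t" unfolding tup_def
    proof (intro conjI allI impI)
      fix a b assume "a < b" "b < k"
      then show "t a < t b" using f_less[of "t a" "t b"] t[of a] t[of b] hm(1)[of a b] by simp
    qed (use t in simp)
    moreover have "tup k n t'" unfolding tup_def
    proof (intro conjI allI impI)
      fix a b assume "a < b" "b < k"
      then show "t' a < t' b" using f_less[of "t' a" "t' b"] t'[of a] t'[of b] hm(2)[of a b] by simp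
    qed (use t' in simp)
    moreover have "P = h ` {..<k}" using h(1) unfolding bij_betw_def by simp
    then have "P = (\<lambda>a. f (t a)) ` {..<k}" "g ` P = (\<lambda>a. f (t' a)) ` {..<k}"
      using t t' by (auto simp: image_image intro!: image_cong)
    ultimately show ?thesis using t t' hA by (intro exI[of _ t] exI[of _ t']) simp
  qed
  have g_less: "x < y \<longleftrightarrow> g x < g y" and g_eq: "x = y \<longleftrightarrow> g x = g y" if "x \<in> A" "y \<in> A" for x y
    using strict_mono_onD[OF g(2), of x y] strict_mono_onD[OF g(2), of y x] that
    by (cases x y rule: linorder_cases; auto)+
  show "monotone_on (nsets A k) (\<lambda>P Q. (P, Q) \<in> r) (\<lambda>P Q. (P, Q) \<in> r) (\<lambda>P. g ` P)"
  proof (rule monotone_onI)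
    fix P Q assume PQ: "P \<in> nsets A k" "Q \<in> nsets A k" "(P, Q) \<in> r"
    from enum[OF PQ(1)] obtain t t' where t: "tup k n t" "tup k n t'" "\<forall>a<k. f (t a) \<in> A \<and> f (t' a) = g (f (t a))"
      "P = (\<lambda>a. f (t a)) ` {..<k}" "g ` P = (\<lambda>a. f (t' a)) ` {..<k}" by (elim exE conjE) (rule that)
    from enum[OF PQ(2)] obtain s s' where s: "tup k n s" "tup k n s'" "\<forall>a<k. f (s a) \<in> A \<and> f (s' a) = g (f (s a))"
      "Q = (\<lambda>a. f (s a)) ` {..<k}" "g ` Q = (\<lambda>a. f (s' a)) ` {..<k}" by (elim exE conjE) (rule that)
    show "(g ` P, g ` Q) \<in> r"
      unfolding t(5) s(5)
    proof (rule inv[OF t(1) s(1) t(2) s(2)])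
      fix a assume a: "a < k"
      have n: "t a < n" "s a < n" "t' a < n" "s' a < n" using t(1,2) s(1,2) a unfolding tup_def by auto
      have m: "f (t a) \<in> A" "f (s a) \<in> A" "f (t' a) = g (f (t a))" "f (s' a) = g (f (s a))"
        using t(3) s(3) a by auto
      show "(t a < s a) = (t' a < s' a)"
        unfolding f_less[OF n(1,2)] f_less[OF n(3,4)] m(3,4) by (rule g_less[OF m(1,2)])
      show "(t a = s a) = (t' a = s' a)"
        unfolding f_eq[OF n(1,2)] f_eq[OF n(3,4)] m(3,4) by (rule g_eq[OF m(1,2)])
    qed (use PQ(3) t(4) s(4) in simp)
  qed
qed

lemma canonical_subset:
  assumes "1 \<le> k"
  shows "\<exists>C\<ge>1. \<forall>n\<ge>2. \<forall>N\<ge>tw k (n ^ C). \<forall>r. strict_linear_order_on (nsets {1..N} k) r \<longrightarrow>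
     (\<exists>X. X \<subseteq> {1..N} \<and> card X = n \<and> canonical k X r)"
proof -
  define A where "A = {(i, j, b :: bool). i < j \<and> j < k}"
  have A_sub: "A \<subseteq> {..<k} \<times> {..<k} \<times> UNIV" unfolding A_def by auto
  then have A: "finite A" by (rule finite_subset) simp
  \<comment> \<open>Colors are subsets of \<open>{..<k}\<close>, so there are at most
    \<open>2 ^ k\<close> of them, and there are \<open>card A\<close> predicates; hence
    \<open>C0\<close> depends on \<open>k\<close> alone. The color has arity \<open>k + 1\<close>,
    which accounts for the \<open>k\<close> exponentials.\<close>
  obtain C0 where C0: "1 \<le> C0" and MR: "\<forall>n N (col :: nat set \<Rightarrow> nat set) (W :: nat \<times> nat \<times> bool \<Rightarrow> nat set \<Rightarrow> bool) Col B d.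
     2 \<le> n \<longrightarrow> finite Col \<longrightarrow> card Col \<le> 2 ^ k \<longrightarrow> Col \<noteq> {} \<longrightarrow> finite B \<longrightarrow> card B \<le> card A \<longrightarrow>
     tw k (n ^ C0) \<le> N \<longrightarrow> (\<forall>V\<in>nsets {..<N} (Suc k). col V \<in> Col) \<longrightarrow>
     (\<forall>a\<in>B. d a \<le> k \<and> deferred_monotone (d a) N (Suc k) col (W a)) \<longrightarrow>
     (\<exists>S\<subseteq>{..<N}. card S = n \<and> (\<forall>V\<in>nsets S (Suc k). \<forall>V'\<in>nsets S (Suc k). col V = col V') \<and>
       (\<forall>a\<in>B. \<forall>V\<in>nsets S (Suc (Suc k)). \<forall>V'\<in>nsets S (Suc (Suc k)). W a V = W a V'))"
    using monotone_ramsey[of k "card A" k] by (elim exE conjE) (rule that)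
  \<comment> \<open>The spacing demanded by \<open>path\<close>: of \<open>g * n\<close> homogeneous
    points only every \<open>g\<close>-th is kept.\<close>
  define g where "g = 2 * k + 1"
  show ?thesis
  \<comment> \<open>For \<open>2 \<le> n\<close> the factor \<open>g\<close> is at most
    \<open>2 ^ g \<le> n ^ g\<close>, so \<open>g * n \<le> n ^ Suc g\<close>.\<close>
  proof (intro exI[of _ "Suc g * C0"] conjI allI impI)
    show "1 \<le> Suc g * C0" using C0 by simp
    fix n N and r :: "nat set rel"
    assume n: "2 \<le> n" and N: "tw k (n ^ (Suc g * C0)) \<le> N" and r: "strict_linear_order_on (nsets {1..N} k) r"
    define m where "m = g * n"
    have "g \<le> 2 ^ g" by (rule less_imp_le) simp
    also have "\<dots> \<le> n ^ g" using n by (rule power_mono) simp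
    finally have "m \<le> n ^ Suc g" unfolding m_def by simp
    then have "m ^ C0 \<le> (n ^ Suc g) ^ C0" by (rule power_mono) simp
    then have "tw k (m ^ C0) \<le> tw k (n ^ (Suc g * C0))" unfolding power_mult by (rule tw_mono)
    with N have mN: "tw k (m ^ C0) \<le> N" by simp
    have m3: "3 * k \<le> m"
    proof -
      have "3 * k \<le> g * 2" unfolding g_def by simp
      also have "\<dots> \<le> m" unfolding m_def using n by (rule mult_le_mono2)
      finally show ?thesis .
    qed
    have m2: "2 \<le> m" using m3 assms by simp
    define r' where "r' = {(P, Q). (Suc ` P, Suc ` Q) \<in> r}"
    have lin: "strict_linear_order_on (nsets {..<N} k) r'"
      unfolding strict_linear_order_on_def
    proof (intro conjI)
      have tr: "trans r" and ir: "irrefl r" and tot: "total_on (nsets {1..N} k) r"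
        using r unfolding strict_linear_order_on_def by auto
      show "trans r'" unfolding r'_def by (rule transI) (auto intro: transD[OF tr])
      show "irrefl r'" using ir unfolding r'_def irrefl_def by auto
      show "total_on (nsets {..<N} k) r'"
      proof (rule total_onI)
        fix P Q assume PQ: "P \<in> nsets {..<N} k" "Q \<in> nsets {..<N} k" "P \<noteq> Q"
        have "Suc ` U \<in> nsets {1..N} k" if "U \<in> nsets {..<N} k" for U
          using that by (auto simp: nsets_def card_image)
        moreover have "Suc ` P \<noteq> Suc ` Q" using PQ(3) by (simp add: inj_image_eq_iff)
        ultimately show "(P, Q) \<in> r' \<or> (Q, P) \<in> r'"
          using tot[unfolded total_on_def, THEN bspec, THEN bspec, THEN mp, of "Suc ` P" "Suc ` Q"] PQ(1,2)
          unfolding r'_def by simp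
      qed
    qed
    have colC: "\<forall>V\<in>nsets {..<N} (Suc k). color k r' V \<in> Pow {..<k}" unfolding color_def by auto
    have cms: "\<forall>a\<in>A. (\<lambda>(i, j, b). k - i) a \<le> k \<and> deferred_monotone ((\<lambda>(i, j, b). k - i) a) N (Suc k) (color k r') (quad r' a)"
    proof
      fix a assume "a \<in> A"
      then obtain i j b where a: "a = (i, j, b)" "i < j" "j < k" unfolding A_def by auto
      show "(\<lambda>(i, j, b). k - i) a \<le> k \<and> deferred_monotone ((\<lambda>(i, j, b). k - i) a) N (Suc k) (color k r') (quad r' a)"
        unfolding a(1) case_prod_conv using deferred_monotone_quad[OF lin a(2,3)] by simp
    qed
    have "\<exists>S\<subseteq>{..<N}. card S = m \<and> (\<forall>V\<in>nsets S (Suc k). \<forall>V'\<in>nsets S (Suc k). color k r' V = color k r' V') \<and>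
       (\<forall>a\<in>A. \<forall>V\<in>nsets S (Suc (Suc k)). \<forall>V'\<in>nsets S (Suc (Suc k)). quad r' a V = quad r' a V')"
      by (rule MR[THEN spec, THEN spec, THEN spec, THEN spec, THEN spec, THEN spec, THEN spec,
            THEN mp, THEN mp, THEN mp, THEN mp, THEN mp, THEN mp, THEN mp, THEN mp, THEN mp,
            OF m2 _ _ _ A order_refl mN colC cms])
        (auto simp: card_Pow)
    then obtain S where S: "S \<subseteq> {..<N}" "card S = m"
      and hcol: "\<forall>V\<in>nsets S (Suc k). \<forall>V'\<in>nsets S (Suc k). color k r' V = color k r' V'"
      and hq: "\<forall>a\<in>A. \<forall>V\<in>nsets S (Suc (Suc k)). \<forall>V'\<in>nsets S (Suc (Suc k)). quad r' a V = quad r' a V'"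
      by (elim exE conjE) (rule that)
    have "finite S" using S(1) by (rule finite_subset) simp
    from ex_bij_betw_strict_mono_card[OF this] obtain e where e: "bij_betw e {..<m} S" "strict_mono_on {..<m} e"
      unfolding S(2) by blast
    have e_less: "e a < e b" if "a < b" "b < m" for a b using strict_mono_onD[OF e(2), of a b] that by simp
    have eS: "e ` {..<m} = S" using e(1) unfolding bij_betw_def by simp
    interpret coord_order k m "\<lambda>p q. ((\<lambda>a. e (p a)) ` {..<k}, (\<lambda>a. e (q a)) ` {..<k}) \<in> r'"
      "\<lambda>i. \<exists>Z\<in>nsets (e ` {..<m}) (Suc k). i \<in> color k r' Z"
      "\<lambda>i j. \<exists>U\<in>nsets (e ` {..<m}) (Suc (Suc k)). quad r' (i, j, True) U"
      "\<lambda>i j. \<exists>U\<in>nsets (e ` {..<m}) (Suc (Suc k)). quad r' (i, j, False) U"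
    proof (rule coord_order_homogeneous[OF lin e_less _ m3])
      show "e ` {..<m} \<subseteq> {..<N}" using eS S(1) by simp
      show "color k r' V = color k r' V'" if "V \<in> nsets (e ` {..<m}) (Suc k)" "V' \<in> nsets (e ` {..<m}) (Suc k)" for V V'
        using hcol that unfolding eS by blast
      show "quad r' (i, j, b) V = quad r' (i, j, b) V'"
        if "i < j" "j < k" "V \<in> nsets (e ` {..<m}) (Suc (Suc k))" "V' \<in> nsets (e ` {..<m}) (Suc (Suc k))" for i j b V V'
      proof -
        have "(i, j, b) \<in> A" using that(1,2) unfolding A_def by simp
        from hq[THEN bspec, OF this, THEN bspec, OF that(3)[unfolded eS], THEN bspec, OF that(4)[unfolded eS]]
        show ?thesis .
      qed
    qed
    define f where "f = (\<lambda>t. Suc (e (g * t)))"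
    have g0: "0 < g" unfolding g_def by simp
    have gm: "g * t < m" if "t < n" for t using that g0 unfolding m_def by simp
    have f: "f a < f b" if "a < b" "b < n" for a b
      using e_less[of "g * a" "g * b"] gm[OF that(2)] that g0 unfolding f_def by simp
    have tg: "tup k m (\<lambda>a. g * t a)" if "tup k n t" for t
      using that gm g0 unfolding tup_def by auto
    have canon: "canonical k (f ` {..<n}) r"
    proof (rule canonicalI[OF f])
      fix t s t' s'
      assume t: "tup k n t" "tup k n s" "tup k n t'" "tup k n s'"
        and lt: "\<And>a. a < k \<Longrightarrow> (t a < s a) = (t' a < s' a)" and eq: "\<And>a. a < k \<Longrightarrow> (t a = s a) = (t' a = s' a)"
        and r: "((\<lambda>a. f (t a)) ` {..<k}, (\<lambda>a. f (s a)) ` {..<k}) \<in> r"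
      have rr: "((\<lambda>a. f (t a)) ` {..<k}, (\<lambda>a. f (s a)) ` {..<k}) \<in> r \<longleftrightarrow>
         ((\<lambda>a. e (g * t a)) ` {..<k}, (\<lambda>a. e (g * s a)) ` {..<k}) \<in> r'" for t s
        unfolding f_def r'_def by (simp add: image_image)
      have dvd: "2 * k + 1 dvd g * t a \<and> 2 * k + 1 dvd g * s a \<and> 2 * k + 1 dvd g * t' a \<and> 2 * k + 1 dvd g * s' a" for a
        unfolding g_def by (intro conjI dvd_triv_left)
      show "((\<lambda>a. f (t' a)) ` {..<k}, (\<lambda>a. f (s' a)) ` {..<k}) \<in> r"
        unfolding rr
        by (rule same_pattern[OF tg[OF t(1)] tg[OF t(2)] tg[OF t(3)] tg[OF t(4)] dvd _ _ r[unfolded rr]])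
          (use lt eq g0 in simp_all)
    qed
    have "inj_on f {..<n}"
    proof (rule inj_onI)
      fix a b assume "a \<in> {..<n}" "b \<in> {..<n}" "f a = f b"
      then show "a = b" using f[of a b] f[of b a] by (cases a b rule: linorder_cases) auto
    qed
    then have "card (f ` {..<n}) = n" by (simp add: card_image)
    moreover have "f ` {..<n} \<subseteq> {1..N}"
    proof
      fix x assume "x \<in> f ` {..<n}"
      then obtain t where "t < n" "x = Suc (e (g * t))" unfolding f_def by auto
      moreover from this have "e (g * t) \<in> S" using gm eS by auto
      ultimately show "x \<in> {1..N}" using S(1) by auto
    qed
    ultimately show "\<exists>X. X \<subseteq> {1..N} \<and> card X = n \<and> canonical k X r" using canon by blast
  qed
qed

theorem theorem1p4:
  fixes k :: nat
  assumes "k \<ge> 2"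
  shows "\<exists>C::real. \<forall>n::nat. n \<ge> 1 \<longrightarrow> real (leeb_number k n) \<le> tower k (real n powr C)"
proof -
  have "1 \<le> k" using assms by simp
  from canonical_subset[OF this] obtain C where C: "1 \<le> C"
    "\<forall>n\<ge>2. \<forall>N\<ge>tw k (n ^ C). \<forall>r. strict_linear_order_on (nsets {1..N} k) r \<longrightarrow>
     (\<exists>X. X \<subseteq> {1..N} \<and> card X = n \<and> canonical k X r)" by blast
  have "leeb_number k n \<le> tw k (n ^ C)" if "1 \<le> n" for n
  \<comment> \<open>For \<open>n = 1\<close> the power \<open>n ^ C\<close> stays at 1 and cannot
    absorb constants. A singleton has no \<open>k\<close>-subsets because \<open>2 \<le> k\<close>,
    so it is canonical for any relation.\<close>
  proof (cases "n = 1")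
    case True
    have "\<exists>X. X \<subseteq> {1..N} \<and> card X = 1 \<and> canonical k X r" if N: "1 \<le> N" for N and r :: "nat set rel"
    proof (intro exI[of _ "{1}"] conjI)
      have "nsets A k = {}" if "A \<subseteq> {1::nat}" for A
      proof -
        have "P \<notin> nsets A k" for P
        proof
          assume "P \<in> nsets A k"
          then have P: "P \<subseteq> {1}" "card P = k" using that by (auto simp: nsets_def)
          then have "card P \<le> card {1::nat}" by (intro card_mono) auto
          with P(2) assms show False by simp
        qed
        then show ?thesis by blast
      qed
      then show "canonical k {1} r" unfolding canonical_def by (simp add: monotone_on_def)
    qed (use N in auto)
    then have "leeb_number k 1 \<le> 1" unfolding leeb_number_def by (intro Least_le) blast
    also have "1 \<le> tw k (n ^ C)"
    proof (cases k)
      case 0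
      then show ?thesis using assms by simp
    next
      case (Suc i)
      then show ?thesis by simp
    qed
    finally show ?thesis using True by simp
  next
    case False
    then have "2 \<le> n" using that by simp
    then show ?thesis unfolding leeb_number_def using C(2) by (intro Least_le) blast
  qed
  moreover have "tower k (real n powr real C) = real (tw k (n ^ C))" if "1 \<le> n" for n
    using tower_tw[of k "n ^ C"] that by (simp add: powr_realpow)
  ultimately have "\<forall>n\<ge>1. real (leeb_number k n) \<le> tower k (real n powr real C)" by simp
  then show ?thesis by blast
qed

end
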